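(* Let $d\ge1$, $\alpha\in(0,1)$, $\theta_0\in\mathbb{R}^d$, and let $X_1,\ldots,X_n$ be independent and identically distributed from $P$. Let $\widehat{\mathrm{CI}}_\alpha$ be the rectangular hull confidence region (described in the context), with batch estimators $\widehat{\theta}^{(j)}$, $1\le j\le B^*$. Suppose that these estimators (for each of the two possible values of $B^*$) satisfy $$\mathrm{O\mbox{-}Med\mbox{-}bias}_P(\widehat{\theta}^{(j)};\theta_0)=\mathtt{OMB}(\mathcal{L}(\widehat{\theta}^{(j)}-\theta_0))\le\delta_{n/B_{\alpha,d}},$$ where $\delta_{n/B_{\alpha,d}}\ge0$ is a real number. Then $$\mathbb{P}(\theta_0\notin\widehat{\mathrm{CI}}_\alpha)\ \le\ \alpha+2^{d-1}B_{\alpha,d}(B_{\alpha,d}-1)\,\delta_{n/B_{\alpha,d}}^2.$$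
   Context: General orthant median bias. Let $U_d=\{-1,0,1\}^d$ and $V_d=\{-1,1\}^d$. For $x\in\mathbb{R}^d$, $\mathrm{sign}(x)\in U_d$ is the vector of coordinatewise signs ($-1,0,1$ according to whether the coordinate is negative, zero, positive). For a probability measure $\mu$ on $\mathbb{R}^d$ and $\eta\in U_d$ let $\mu_{\mathrm{sgn}}(\eta)=\mu(\{x:\mathrm{sign}(x)=\eta\})$. For $\eta,\eta'\in U_d$ write $\eta\preceq_s\eta'$ if $\eta_j=\eta_j'$ for all $j$ with $\eta_j\ne0$, and $\eta_j\le|\eta_j'|$ for all $j$ with $\eta_j=0$ (the latter is automatic). A probability measure $\nu$ on $\mathbb{R}^d$ is MCH ($\nu\in\mathrm{MCH}$) if $\nu(\{x:x_j=0\text{ for some }j\})=0$. A probability measure $\lambda$ is obtained from $\mu$ by an elementary operation, written $\lambda=\mathcal{E}(\mu)$, if there exist $q\ge0$ and $\eta\in U_d\setminus V_d$, $\eta'\in U_d$ with $\eta\preceq_s\eta'$ such that $\mu_{\mathrm{sgn}}(\gamma)=\lambda_{\mathrm{sgn}}(\gamma)$ for all $\gamma\in U_d\setminus\{\eta,\eta'\}$, $\mu_{\mathrm{sgn}}(\eta)\ge q$, $\lambda_{\mathrm{sgn}}(\eta)=\mu_{\mathrm{sgn}}(\eta)-q$, and $\lambda_{\mathrm{sgn}}(\eta')=\mu_{\mathrm{sgn}}(\eta')+q$. Write $\mu\preceq_{\mathrm{MCH}}\nu$ if $\nu=\mathcal{E}_k\cdots\mathcal{E}_1(\mu)$ for some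 finite sequence of elementary operations. Define $$\mathtt{OMB}(\mu):=\inf_{\nu\in\mathrm{MCH}:\,\mu\preceq_{\mathrm{MCH}}\nu}2^{d-1}\left(\frac1{2^d}-\min_{\eta\in V_d}\nu_{\mathrm{sgn}}(\eta)\right)_+,\qquad (t)_+=\max\{t,0\},$$ and $\mathrm{O\mbox{-}Med\mbox{-}bias}_P(\widehat{\theta};\theta_0):=\mathtt{OMB}(\mathcal{L}(\widehat{\theta}-\theta_0))$, where $\mathcal{L}(Y)$ is the law of $Y$. Rectangular hull confidence region. Let $\mathcal{A}(\cdot)$ be an estimation procedure that takes observations as input and returns an estimator in $\mathbb{R}^d$. For integers $B\ge1$ let $$U(B,0;d):=\sum_{j=1}^d(-1)^{j-1}\binom dj2^j\left(\frac1{2^j}\right)^B = 1-(1-2^{-B+1})^d.$$ Set $B_{\alpha,d}:=\left\lceil 1-\log_2\left(1-(1-\alpha)^{1/d}\right)\right\rceil$ (assume $n\ge B_{\alpha,d}$). Generate a random variable $V\sim\mathrm{Uniform}[0,1]$ independent of the data, and set $$\tau_{\alpha,d}:=\frac{\alpha-U(B_{\alpha,d},0;d)}{U(B_{\alpha,d}-1,0;d)-U(B_{\alpha,d},0;d)},\qquad B^*:=\begin{cases}B_{\alpha,d}-1,&V\le\tau_{\alpha,d},\\ B_{\alpha,d},&V>\tau_{\alpha,d}.\end{cases}$$ Randomly (independently of the data values) split $X_1,\ldots,X_n$ into $B^*$ disjoint batches $\{X_i:i\in S_j\}$, $1\le j\le B^*$, all of equal size $\lfloor n/B^*\rfloor$,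 discarding some observations if needed. Compute $\widehat{\theta}^{(j)}:=\mathcal{A}(\{X_i:i\in S_j\})$ for $1\le j\le B^*$, and return $$\widehat{\mathrm{CI}}_\alpha:=\prod_{j=1}^d\left[\min_{1\le k\le B^*}e_j^\top\widehat{\theta}^{(k)},\ \max_{1\le k\le B^*}e_j^\top\widehat{\theta}^{(k)}\right],$$ where $e_j$ is the $j$-th canonical basis vector of $\mathbb{R}^d$. *)

theory Defs
  imports "HOL-Probability.Probability"
begin

section \<open>Orthant median bias\<close>

text \<open>The ambient dimension is \<open>d = CARD('d)\<close>. Probability measures on the Euclidean space are the
  elements of \<open>space (prob_algebra borel)\<close>. Note that the library function \<^const>\<open>sgn\<close> on vectors
  normalises to length one, so it is applied to each coordinate here.\<close>

definition sign_vec :: "real ^ 'd \<Rightarrow> real ^ 'd::finite" where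
  "sign_vec x = (\<chi> j. sgn (x $ j))"

definition sign_U :: "(real ^ 'd::finite) set" where
  "sign_U = {\<eta>. \<forall>j. \<eta> $ j \<in> {-1, 0, 1}}"

definition sign_V :: "(real ^ 'd::finite) set" where
  "sign_V = {\<eta>. \<forall>j. \<eta> $ j \<in> {-1, 1}}"

definition sgn_mass :: "(real ^ 'd::finite) measure \<Rightarrow> real ^ 'd \<Rightarrow> real" where
  "sgn_mass \<mu> \<eta> = measure \<mu> {x. sign_vec x = \<eta>}"

definition sign_le :: "real ^ 'd::finite \<Rightarrow> real ^ 'd \<Rightarrow> bool" (infix "\<preceq>\<^sub>s" 50) where
  "\<eta> \<preceq>\<^sub>s \<eta>' \<longleftrightarrow> (\<forall>j. (\<eta> $ j \<noteq> 0 \<longrightarrow> \<eta> $ j = \<eta>' $ j) \<and> (\<eta> $ j = 0 \<longrightarrow> \<eta> $ j \<le> \<bar>\<eta>' $ j\<bar>))"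

definition MCH :: "(real ^ 'd::finite) measure set" where
  "MCH = {\<nu> \<in> space (prob_algebra borel). measure \<nu> {x. \<exists>j. x $ j = 0} = 0}"

definition elementary_op :: "(real ^ 'd::finite) measure \<Rightarrow> (real ^ 'd) measure \<Rightarrow> bool" where
  "elementary_op \<mu> \<kappa> \<longleftrightarrow>
     \<mu> \<in> space (prob_algebra borel) \<and> \<kappa> \<in> space (prob_algebra borel) \<and>
     (\<exists>q \<ge> 0. \<exists>\<eta> \<in> sign_U - sign_V. \<exists>\<eta>' \<in> sign_U. \<eta> \<preceq>\<^sub>s \<eta>' \<and>
        (\<forall>\<gamma> \<in> sign_U - {\<eta>, \<eta>'}. sgn_mass \<mu> \<gamma> = sgn_mass \<kappa> \<gamma>) \<and>
        q \<le> sgn_mass \<mu> \<eta> \<and>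
        sgn_mass \<kappa> \<eta> = sgn_mass \<mu> \<eta> - q \<and>
        sgn_mass \<kappa> \<eta>' = sgn_mass \<mu> \<eta>' + q)"

text \<open>Allowing the empty sequence of operations makes no difference: \<open>q = 0\<close> is permitted.\<close>

definition mch_le :: "(real ^ 'd::finite) measure \<Rightarrow> (real ^ 'd) measure \<Rightarrow> bool"
    (infix "\<preceq>\<^sub>M\<^sub>C\<^sub>H" 50) where
  "\<mu> \<preceq>\<^sub>M\<^sub>C\<^sub>H \<nu> \<longleftrightarrow> elementary_op\<^sup>*\<^sup>* \<mu> \<nu>"

definition OMB :: "(real ^ 'd::finite) measure \<Rightarrow> real" where
  "OMB \<mu> = (INF \<nu> \<in> {\<nu> \<in> MCH. \<mu> \<preceq>\<^sub>M\<^sub>C\<^sub>H \<nu>}.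
     2 ^ (CARD('d) - 1) * max (1 / 2 ^ CARD('d) - Min (sgn_mass \<nu> ` sign_V)) 0)"

definition o_med_bias ::
    "'w measure \<Rightarrow> ('w \<Rightarrow> real ^ 'd::finite) \<Rightarrow> real ^ 'd \<Rightarrow> real" where
  "o_med_bias M T \<theta>\<^sub>0 = OMB (distr M borel (\<lambda>\<omega>. T \<omega> - \<theta>\<^sub>0))"

section \<open>Rectangular hull confidence region\<close>

definition hull_U :: "nat \<Rightarrow> nat \<Rightarrow> real" where
  "hull_U B d = (\<Sum>j = 1..d. (-1) ^ (j - 1) * real (d choose j) * 2 ^ j * (1 / 2 ^ j) ^ B)"

text \<open>For \<open>d \<ge> 1\<close> and \<open>0 < \<alpha> < 1\<close> the ceiling below is at least 2.\<close>

definition batch_number :: "real \<Rightarrow> nat \<Rightarrow> nat" where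
  "batch_number \<alpha> d = nat \<lceil>1 - log 2 (1 - (1 - \<alpha>) powr (1 / real d))\<rceil>"

definition rand_threshold :: "real \<Rightarrow> nat \<Rightarrow> real" where
  "rand_threshold \<alpha> d =
     (\<alpha> - hull_U (batch_number \<alpha> d) d) /
     (hull_U (batch_number \<alpha> d - 1) d - hull_U (batch_number \<alpha> d) d)"

definition rand_batch_number :: "real \<Rightarrow> nat \<Rightarrow> real \<Rightarrow> nat" where
  "rand_batch_number \<alpha> d v =
     (if v \<le> rand_threshold \<alpha> d then batch_number \<alpha> d - 1 else batch_number \<alpha> d)"

definition batch_splits :: "nat \<Rightarrow> nat \<Rightarrow> (nat \<Rightarrow> nat set) set" where
  "batch_splits n b = {S \<in> {1..b} \<rightarrow>\<^sub>E Pow {1..n}.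
     disjoint_family_on S {1..b} \<and> (\<forall>j \<in> {1..b}. card (S j) = n div b)}"

text \<open>A procedure acts on data sets of any size, given as lists; it need not be symmetric
  in the observations.\<close>

definition estimation_procedure :: "'x measure \<Rightarrow> ('x list \<Rightarrow> real ^ 'd::finite) \<Rightarrow> bool" where
  "estimation_procedure P A \<longleftrightarrow>
     (\<forall>m. (\<lambda>x. A (map x [0..<m])) \<in> borel_measurable (Pi\<^sub>M {0..<m} (\<lambda>_. P)))"

definition batch_estimator ::
    "('x list \<Rightarrow> real ^ 'd::finite) \<Rightarrow> (nat \<Rightarrow> 'x) \<Rightarrow> (nat \<Rightarrow> nat set) \<Rightarrow> nat \<Rightarrow> real ^ 'd" where
  "batch_estimator A x S j = A (map x (sorted_list_of_set (S j)))"

definition rect_hull :: "nat \<Rightarrow> (nat \<Rightarrow> real ^ 'd::finite) \<Rightarrow> (real ^ 'd) set" where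
  "rect_hull b t = {y. \<forall>j. y $ j \<in> {Min ((\<lambda>k. t k $ j) ` {1..b}) .. Max ((\<lambda>k. t k $ j) ` {1..b})}}"

text \<open>The library's \<^const>\<open>prob_space.indep_var\<close> requires both random variables to have the same
  type; this is its heterogeneous version.\<close>

definition indep_rvs ::
    "'w measure \<Rightarrow> 'a measure \<Rightarrow> ('w \<Rightarrow> 'a) \<Rightarrow> 'b measure \<Rightarrow> ('w \<Rightarrow> 'b) \<Rightarrow> bool" where
  "indep_rvs M N Y K Z \<longleftrightarrow>
     Y \<in> measurable M N \<and> Z \<in> measurable M K \<and>
     prob_space.indep_set M
       {Y -` E \<inter> space M | E. E \<in> sets N} {Z -` E \<inter> space M | E. E \<in> sets K}"

text \<open>Arguments: the data \<open>x\<close>, the uniform variate \<open>v\<close>, and, for either possible number \<open>b\<close> of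
  batches, the split \<open>S b\<close> that is used when \<open>b\<close> is selected.\<close>

definition hull_CI ::
    "real \<Rightarrow> ('x list \<Rightarrow> real ^ 'd::finite) \<Rightarrow> (nat \<Rightarrow> 'x) \<Rightarrow> real \<Rightarrow> (nat \<Rightarrow> nat \<Rightarrow> nat set) \<Rightarrow>
     (real ^ 'd) set" where
  "hull_CI \<alpha> A x v S =
     (let b = rand_batch_number \<alpha> CARD('d) v in rect_hull b (batch_estimator A x (S b)))"

end

theory Submission
  imports Defs
begin

text \<open>The point \<open>\<theta>\<^sub>0\<close> is missed by the hull of \<open>b\<close> batch estimators iff in some coordinate all
  errors have the same strict sign, and the probability of this depends on the sign law of an
  estimator only. It can only grow when zero signs are replaced by non-zero ones, so one may pass
  to a law \<open>\<nu>\<close> in \<open>MCH\<close> whose orthant masses are all at least \<open>(1 - 2\<delta>) / 2\<^sup>d\<close>, up to an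
  arbitrarily small loss in \<open>\<delta>\<close>. If \<open>2\<delta> \<le> 1\<close>, such a sign law is the mixture, with weights \<open>1 -
  2\<delta>\<close> and \<open>2\<delta>\<close>, of the uniform law on the orthants and some other law. If at most one of the \<open>b\<close>
  errors is drawn from the latter, the conditional probability of a miss is, by the reflection
  symmetry of the remaining ones, exactly as in the unbiased case; two or more such draws happen
  with probability at most \<open>2b(b - 1)\<delta>\<^sup>2\<close>, which suffices for \<open>d \<ge> 2\<close>. The randomisation of the
  number of batches is chosen so that the miss probability of the unbiased case averages to \<open>\<alpha>\<close>.\<close>

section \<open>Sign patterns\<close>

definition one_sided :: "'i set \<Rightarrow> ('i \<Rightarrow> real ^ 'd) \<Rightarrow> bool" where
  "one_sided I \<eta> \<longleftrightarrow> (\<exists>j. (\<forall>k\<in>I. \<eta> k $ j = 1) \<or> (\<forall>k\<in>I. \<eta> k $ j = -1))"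

text \<open>The probability of \<open>one_sided\<close> when the signs indexed by \<open>I\<close>
  are drawn independently with masses \<open>p\<close>. As a finite sum it is a polynomial in the
  masses, so two sign laws can be compared without constructing random variables.\<close>

definition one_sided_prob :: "'i set \<Rightarrow> (real ^ 'd::finite \<Rightarrow> real) \<Rightarrow> real" where
  "one_sided_prob I p = (\<Sum>\<eta>\<in>{\<eta> \<in> I \<rightarrow>\<^sub>E sign_U. one_sided I \<eta>}. \<Prod>k\<in>I. p (\<eta> k))"

text \<open>Carries finiteness and cardinality of function spaces over to \<open>sign_U\<close> and
  \<open>sign_V\<close>.\<close>

lemma vec_box_eq_image:
  "{x :: 'a ^ 'd::finite. \<forall>j. x $ j \<in> Y} = vec_lambda ` (UNIV \<rightarrow>\<^sub>E Y)"
proof safe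
  fix x :: "'a ^ 'd" assume "\<forall>j. x $ j \<in> Y"
  then have "vec_nth x \<in> UNIV \<rightarrow>\<^sub>E Y" by auto
  then show "x \<in> vec_lambda ` (UNIV \<rightarrow>\<^sub>E Y)"
    by (metis imageI vec_nth_inverse)
qed auto

lemma finite_sign_U [simp]: "finite (sign_U :: (real ^ 'd::finite) set)"
  unfolding sign_U_def vec_box_eq_image by (intro finite_imageI finite_PiE) auto

lemma sign_V_subset_sign_U: "sign_V \<subseteq> sign_U"
  by (auto simp: sign_U_def sign_V_def)

lemma finite_sign_V [simp]: "finite (sign_V :: (real ^ 'd::finite) set)"
  using finite_subset[OF sign_V_subset_sign_U] by simp

lemma card_sign_V: "card (sign_V :: (real ^ 'd::finite) set) = 2 ^ CARD('d)"
proof -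
  have "inj_on (vec_lambda :: ('d \<Rightarrow> real) \<Rightarrow> real ^ 'd) (UNIV \<rightarrow>\<^sub>E {-1, 1})"
    by (auto intro!: inj_onI simp: vec_eq_iff fun_eq_iff)
  then show ?thesis
    unfolding sign_V_def vec_box_eq_image by (simp add: card_image card_PiE numeral_2_eq_2)
qed

lemma sign_vec_in_sign_U: "sign_vec x \<in> sign_U"
  by (auto simp: sign_vec_def sign_U_def sgn_if)

section \<open>Monotonicity under elementary operations\<close>

lemma sum_PiE_insert:
  assumes "x \<notin> I"
  shows "(\<Sum>\<eta>\<in>insert x I \<rightarrow>\<^sub>E U. f \<eta>) = (\<Sum>\<zeta>\<in>U. \<Sum>\<eta>\<in>I \<rightarrow>\<^sub>E U. f (\<eta>(x := \<zeta>)))"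
proof -
  have "inj_on (\<lambda>(y, g). g(x := y)) (U \<times> (I \<rightarrow>\<^sub>E U))"
    using assms by (rule inj_combinator)
  then show ?thesis
    by (simp add: PiE_insert_eq sum.reindex sum.cartesian_product split_def)
qed

text \<open>Domination tested on \<open>r\<close>-monotone functions passes to product weights
  because \<open>p\<close> can be exchanged for \<open>q\<close> one factor at a time: first in the
  old positions, by induction for each fixed value at the new one, then at the new position.\<close>

lemma sum_prod_mono_of_dominated:
  fixes p q :: "'a \<Rightarrow> real" and h :: "('i \<Rightarrow> 'a) \<Rightarrow> real"
  assumes "finite I"
    and nonneg: "\<And>\<zeta>. \<zeta> \<in> U \<Longrightarrow> 0 \<le> p \<zeta>" "\<And>\<zeta>. \<zeta> \<in> U \<Longrightarrow> 0 \<le> q \<zeta>"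
    and dom: "\<And>H :: 'a \<Rightarrow> real. (\<And>\<zeta> \<zeta>'. \<zeta> \<in> U \<Longrightarrow> \<zeta>' \<in> U \<Longrightarrow> r \<zeta> \<zeta>' \<Longrightarrow> H \<zeta> \<le> H \<zeta>') \<Longrightarrow>
      (\<Sum>\<zeta>\<in>U. p \<zeta> * H \<zeta>) \<le> (\<Sum>\<zeta>\<in>U. q \<zeta> * H \<zeta>)"
    and "\<And>k \<zeta> \<zeta>' \<eta>. k \<in> I \<Longrightarrow> \<zeta> \<in> U \<Longrightarrow> \<zeta>' \<in> U \<Longrightarrow> r \<zeta> \<zeta>' \<Longrightarrow> h (\<eta>(k := \<zeta>)) \<le> h (\<eta>(k := \<zeta>'))"
  shows "(\<Sum>\<eta>\<in>I \<rightarrow>\<^sub>E U. h \<eta> * (\<Prod>k\<in>I. p (\<eta> k))) \<le> (\<Sum>\<eta>\<in>I \<rightarrow>\<^sub>E U. h \<eta> * (\<Prod>k\<in>I. q (\<eta> k)))"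
  using assms(1,5)
proof (induction I arbitrary: h rule: finite_induct)
  case empty
  then show ?case by simp
next
  case (insert x I)
  have split: "(\<Sum>\<eta>\<in>insert x I \<rightarrow>\<^sub>E U. h \<eta> * (\<Prod>k\<in>insert x I. w (\<eta> k))) =
      (\<Sum>\<zeta>\<in>U. w \<zeta> * (\<Sum>\<eta>\<in>I \<rightarrow>\<^sub>E U. h (\<eta>(x := \<zeta>)) * (\<Prod>k\<in>I. w (\<eta> k))))" for w :: "'a \<Rightarrow> real"
  proof -
    have "(\<Prod>k\<in>I. w (if k = x then \<zeta> else \<eta> k)) = (\<Prod>k\<in>I. w (\<eta> k))" for \<eta> \<zeta>
      using insert.hyps by (intro prod.cong) auto
    then show ?thesis
      using insert.hyps by (simp add: sum_PiE_insert sum_distrib_left mult_ac)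
  qed
  have "(\<Sum>\<zeta>\<in>U. p \<zeta> * (\<Sum>\<eta>\<in>I \<rightarrow>\<^sub>E U. h (\<eta>(x := \<zeta>)) * (\<Prod>k\<in>I. p (\<eta> k))))
      \<le> (\<Sum>\<zeta>\<in>U. p \<zeta> * (\<Sum>\<eta>\<in>I \<rightarrow>\<^sub>E U. h (\<eta>(x := \<zeta>)) * (\<Prod>k\<in>I. q (\<eta> k))))"
  proof (rule sum_mono, rule mult_left_mono[OF _ nonneg(1)])
    fix \<theta>
    show "(\<Sum>\<eta>\<in>I \<rightarrow>\<^sub>E U. h (\<eta>(x := \<theta>)) * (\<Prod>k\<in>I. p (\<eta> k)))
        \<le> (\<Sum>\<eta>\<in>I \<rightarrow>\<^sub>E U. h (\<eta>(x := \<theta>)) * (\<Prod>k\<in>I. q (\<eta> k)))"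
    proof (rule insert.IH)
      fix k \<zeta> \<zeta>' \<eta> assume *: "k \<in> I" "\<zeta> \<in> U" "\<zeta>' \<in> U" "r \<zeta> \<zeta>'"
      then have "k \<noteq> x" using insert.hyps by auto
      show "h (\<eta>(k := \<zeta>, x := \<theta>)) \<le> h (\<eta>(k := \<zeta>', x := \<theta>))"
        unfolding fun_upd_twist[OF \<open>k \<noteq> x\<close>] using * by (intro insert.prems) auto
    qed
  qed
  \<comment> \<open>Summing out the old positions against non-negative weights leaves a function of
    \<zeta> that is still \<open>r\<close>-monotone, so \<open>dom\<close> applies to it.\<close>
  also have "\<dots> \<le> (\<Sum>\<zeta>\<in>U. q \<zeta> * (\<Sum>\<eta>\<in>I \<rightarrow>\<^sub>E U. h (\<eta>(x := \<zeta>)) * (\<Prod>k\<in>I. q (\<eta> k))))"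
    by (intro dom sum_mono mult_right_mono prod_nonneg insert.prems nonneg) auto
  finally show ?case unfolding split .
qed

text \<open>An operation moves mass \<open>q\<close> upwards from \<open>\<eta>\<close> to
  \<open>\<eta>'\<close>, which changes the sum by
  \<open>q * (H \<eta>' - H \<eta>)\<close>.\<close>

lemma elementary_op_dominated:
  fixes \<mu> \<kappa> :: "(real ^ 'd::finite) measure" and H :: "real ^ 'd \<Rightarrow> real"
  assumes "elementary_op \<mu> \<kappa>"
    and H: "\<And>\<zeta> \<zeta>'. \<zeta> \<in> sign_U \<Longrightarrow> \<zeta>' \<in> sign_U \<Longrightarrow> \<zeta> \<preceq>\<^sub>s \<zeta>' \<Longrightarrow> H \<zeta> \<le> H \<zeta>'"
  shows "(\<Sum>\<zeta>\<in>sign_U. sgn_mass \<mu> \<zeta> * H \<zeta>) \<le> (\<Sum>\<zeta>\<in>sign_U. sgn_mass \<kappa> \<zeta> * H \<zeta>)"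
proof -
  from assms(1) obtain q \<eta> \<eta>' where q: "0 \<le> q"
    and U: "\<eta> \<in> sign_U" "\<eta>' \<in> sign_U" "\<eta> \<preceq>\<^sub>s \<eta>'"
    and eq: "\<And>\<gamma>. \<gamma> \<in> sign_U - {\<eta>, \<eta>'} \<Longrightarrow> sgn_mass \<mu> \<gamma> = sgn_mass \<kappa> \<gamma>"
      "sgn_mass \<kappa> \<eta> = sgn_mass \<mu> \<eta> - q" "sgn_mass \<kappa> \<eta>' = sgn_mass \<mu> \<eta>' + q"
    unfolding elementary_op_def by auto
  show ?thesis
  proof (cases "\<eta> = \<eta>'")
    \<comment> \<open>Here the two mass equations force \<open>q = 0\<close>.\<close>
    case True
    then have "sgn_mass \<mu> \<gamma> = sgn_mass \<kappa> \<gamma>" if "\<gamma> \<in> sign_U" for \<gamma>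
      using eq that by (cases "\<gamma> = \<eta>") auto
    then show ?thesis by simp
  next
    case False
    have split: "(\<Sum>\<zeta>\<in>sign_U. f \<zeta>) = f \<eta> + f \<eta>' + (\<Sum>\<zeta>\<in>sign_U - {\<eta>, \<eta>'}. f \<zeta>)"
      for f :: "real ^ 'd \<Rightarrow> real"
      using sum.subset_diff[of "{\<eta>, \<eta>'}" sign_U f] U False by simp
    have "0 \<le> q * (H \<eta>' - H \<eta>)"
      using q H[OF U] by simp
    moreover have "(\<Sum>\<zeta>\<in>sign_U - {\<eta>, \<eta>'}. sgn_mass \<mu> \<zeta> * H \<zeta>) = (\<Sum>\<zeta>\<in>sign_U - {\<eta>, \<eta>'}. sgn_mass \<kappa> \<zeta> * H \<zeta>)"
      using eq(1) by simp
    ultimately show ?thesis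
      unfolding split[of "\<lambda>\<zeta>. sgn_mass _ \<zeta> * H \<zeta>"] eq(2,3) by (simp add: algebra_simps)
  qed
qed

lemma mch_le_dominated:
  fixes \<mu> \<nu> :: "(real ^ 'd::finite) measure" and H :: "real ^ 'd \<Rightarrow> real"
  assumes "\<mu> \<preceq>\<^sub>M\<^sub>C\<^sub>H \<nu>"
    and "\<And>\<zeta> \<zeta>'. \<zeta> \<in> sign_U \<Longrightarrow> \<zeta>' \<in> sign_U \<Longrightarrow> \<zeta> \<preceq>\<^sub>s \<zeta>' \<Longrightarrow> H \<zeta> \<le> H \<zeta>'"
  shows "(\<Sum>\<zeta>\<in>sign_U. sgn_mass \<mu> \<zeta> * H \<zeta>) \<le> (\<Sum>\<zeta>\<in>sign_U. sgn_mass \<nu> \<zeta> * H \<zeta>)"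
  using assms(1) unfolding mch_le_def
proof (induction rule: rtranclp_induct)
  case (step \<kappa> \<kappa>')
  then show ?case
    using elementary_op_dominated[OF step.hyps(2), of H] assms(2) by force
qed simp

lemma sum_restrict_of_bool:
  "finite A \<Longrightarrow> (\<Sum>x\<in>{x\<in>A. P x}. f x) = (\<Sum>x\<in>A. of_bool (P x) * f x :: real)"
  by (auto simp: sum.inter_filter of_bool_def intro!: sum.cong)

text \<open>\<open>one_sided\<close> asks only for entries 1 or -1, and these survive when a sign
  vector is replaced by one above it. Its indicator is therefore monotone in every position.\<close>

lemma one_sided_prob_mono:
  fixes \<mu> \<nu> :: "(real ^ 'd::finite) measure"
  assumes "\<mu> \<preceq>\<^sub>M\<^sub>C\<^sub>H \<nu>" and "finite I"
  shows "one_sided_prob I (sgn_mass \<mu>) \<le> one_sided_prob I (sgn_mass \<nu>)"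
proof -
  let ?h = "\<lambda>\<eta>. of_bool (one_sided I \<eta>) :: real"
  have mono: "?h (\<eta>(k := \<zeta>)) \<le> ?h (\<eta>(k := \<zeta>'))" if "\<zeta> \<preceq>\<^sub>s \<zeta>'" for k \<zeta> \<zeta>' and \<eta> :: "'a \<Rightarrow> real ^ 'd"
  proof -
    have "one_sided I (\<eta>(k := \<zeta>'))" if "one_sided I (\<eta>(k := \<zeta>))"
    proof -
      have "\<zeta>' $ j = c" if "\<zeta> $ j = c" "c \<noteq> 0" for j c
        using that \<open>\<zeta> \<preceq>\<^sub>s \<zeta>'\<close> by (auto simp: sign_le_def)
      then have "(\<eta>(k := \<zeta>')) i $ j = c" if "(\<eta>(k := \<zeta>)) i $ j = c" "c \<noteq> 0" for i j c
        using that by (auto split: if_splits)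
      then show ?thesis
        using that unfolding one_sided_def
        by (metis (no_types, lifting) neg_equal_0_iff_equal zero_neq_one)
    qed
    then show ?thesis by auto
  qed
  have "(\<Sum>\<eta>\<in>I \<rightarrow>\<^sub>E sign_U. ?h \<eta> * (\<Prod>k\<in>I. sgn_mass \<mu> (\<eta> k)))
      \<le> (\<Sum>\<eta>\<in>I \<rightarrow>\<^sub>E sign_U. ?h \<eta> * (\<Prod>k\<in>I. sgn_mass \<nu> (\<eta> k)))"
    using assms mch_le_dominated[OF assms(1)] mono
    by (intro sum_prod_mono_of_dominated[where r = sign_le]) (auto simp: sgn_mass_def)
  then show ?thesis
    using assms(2) by (simp add: one_sided_prob_def sum_restrict_of_bool finite_PiE)
qed

section \<open>Sign patterns without zeros\<close>

definition two_sided :: "'i set \<Rightarrow> ('i \<Rightarrow> real ^ 'd::finite) set" where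
  "two_sided I = {\<eta> \<in> I \<rightarrow>\<^sub>E sign_V. \<not> one_sided I \<eta>}"

text \<open>Transposing a pattern gives one sign sequence over \<open>I\<close> per coordinate.
  Being two-sided means that none of them is constant, and the coordinates choose freely among the
  non-constant ones.\<close>

lemma card_two_sided:
  assumes "finite I" and "I \<noteq> {}"
  shows "real (card (two_sided I :: ('i \<Rightarrow> real ^ 'd::finite) set)) = (2 ^ card I - 2) ^ CARD('d)"
proof -
  let ?s = "I \<rightarrow>\<^sub>E {-1, 1 :: real}"
  define N where "N = {s \<in> ?s. (\<exists>k\<in>I. s k \<noteq> 1) \<and> (\<exists>k\<in>I. s k \<noteq> -1)}"
  let ?c = "\<lambda>t :: real. \<lambda>k\<in>I. t"
  have N_eq: "N = ?s - {?c 1, ?c (-1)}"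
    unfolding N_def by (auto simp: fun_eq_iff PiE_iff extensional_def)
  have "?c 1 \<noteq> ?c (-1)"
    using assms(2) by (auto simp: fun_eq_iff)
  then have "card {?c 1, ?c (-1)} = 2" by simp
  moreover have "{?c 1, ?c (-1)} \<subseteq> ?s" by auto
  moreover have "card ?s = 2 ^ card I"
    using assms(1) by (simp add: card_PiE numeral_2_eq_2)
  ultimately have card_N: "real (card N) = 2 ^ card I - 2"
    unfolding N_eq using assms(1) card_mono[of ?s "{?c 1, ?c (-1)}"]
    by (simp add: card_Diff_subset finite_PiE)
  have "bij_betw (\<lambda>\<eta>. \<lambda>j. \<lambda>k\<in>I. \<eta> k $ j) (two_sided I :: ('i \<Rightarrow> real ^ 'd) set) (UNIV \<rightarrow>\<^sub>E N)"
    by (rule bij_betw_byWitness[where f' = "\<lambda>s. \<lambda>k\<in>I. \<chi> j. s j k"])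
      (force simp: two_sided_def one_sided_def N_def sign_V_def PiE_iff extensional_def fun_eq_iff
        vec_eq_iff)+
  from bij_betw_same_card[OF this] show ?thesis
    by (simp add: card_PiE card_N)
qed

text \<open>Vectors multiply coordinatewise, so elements of \<open>sign_V\<close> act as reflections
  in coordinate hyperplanes.\<close>

lemma sign_V_mult_self: "\<sigma> \<in> sign_V \<Longrightarrow> \<sigma> * (\<sigma> * x) = x"
  by (auto simp: sign_V_def vec_eq_iff) (metis mult_1 mult_minus_left minus_minus)

lemma sign_V_mult: "\<sigma> \<in> sign_V \<Longrightarrow> x \<in> sign_V \<Longrightarrow> \<sigma> * x \<in> sign_V"
  by (auto simp: sign_V_def) (metis mult_1 mult_minus_left minus_minus)+

lemma bij_betw_reflect_sign_V:
  assumes "x \<in> sign_V"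
  shows "bij_betw (\<lambda>\<sigma>. \<sigma> * x) sign_V sign_V"
  using assms
  by (intro bij_betw_byWitness[where f' = "\<lambda>\<sigma>. x * \<sigma>"])
    (auto simp: sign_V_mult sign_V_mult_self mult.commute[of _ x])

text \<open>In each coordinate a reflection either keeps or exchanges the two alternatives of
  \<open>one_sided\<close>.\<close>

lemma one_sided_reflect:
  assumes "\<sigma> \<in> sign_V"
  shows "one_sided I (\<lambda>k\<in>I. \<sigma> * \<eta> k) \<longleftrightarrow> one_sided I \<eta>"
proof -
  have "(\<forall>k\<in>I. (\<lambda>k\<in>I. \<sigma> * \<eta> k) k $ j = 1) \<or> (\<forall>k\<in>I. (\<lambda>k\<in>I. \<sigma> * \<eta> k) k $ j = -1) \<longleftrightarrow>
      (\<forall>k\<in>I. \<eta> k $ j = 1) \<or> (\<forall>k\<in>I. \<eta> k $ j = -1)" for j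
  proof -
    have "\<sigma> $ j = 1 \<or> \<sigma> $ j = -1" using assms by (auto simp: sign_V_def)
    then show ?thesis by (auto simp: minus_equation_iff[of _ 1])
  qed
  then show ?thesis unfolding one_sided_def by simp
qed

lemma bij_betw_reflect_two_sided:
  assumes "\<sigma> \<in> sign_V"
  shows "bij_betw (\<lambda>\<eta>. \<lambda>k\<in>I. \<sigma> * \<eta> k) (two_sided I) (two_sided I)"
  using assms
  by (intro bij_betw_byWitness[where f' = "\<lambda>\<eta>. \<lambda>k\<in>I. \<sigma> * \<eta> k"])
    (auto simp: two_sided_def one_sided_reflect sign_V_mult sign_V_mult_self PiE_iff extensional_def
      fun_eq_iff)

text \<open>The set of two-sided patterns is invariant under reflections, which act transitively on the
  orthants, so all orthants are equally frequent at any given position.\<close>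

lemma sum_two_sided_component:
  fixes \<rho> :: "real ^ 'd::finite \<Rightarrow> real"
  assumes "finite I" and "k \<in> I"
  shows "(\<Sum>\<eta>\<in>two_sided I. \<rho> (\<eta> k)) =
    real (card (two_sided I :: ('i \<Rightarrow> real ^ 'd) set)) / 2 ^ CARD('d) * sum \<rho> sign_V"
proof -
  let ?C = "two_sided I :: ('i \<Rightarrow> real ^ 'd) set"
  have "2 ^ CARD('d) * (\<Sum>\<eta>\<in>?C. \<rho> (\<eta> k)) = (\<Sum>\<sigma>\<in>(sign_V :: (real ^ 'd) set). \<Sum>\<eta>\<in>?C. \<rho> (\<eta> k))"
    by (simp add: card_sign_V)
  also have "\<dots> = (\<Sum>\<sigma>\<in>sign_V. \<Sum>\<eta>\<in>?C. \<rho> (\<sigma> * \<eta> k))"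
  proof (rule sum.cong[OF refl])
    fix \<sigma> :: "real ^ 'd" assume "\<sigma> \<in> sign_V"
    then show "(\<Sum>\<eta>\<in>?C. \<rho> (\<eta> k)) = (\<Sum>\<eta>\<in>?C. \<rho> (\<sigma> * \<eta> k))"
      using sum.reindex_bij_betw[OF bij_betw_reflect_two_sided, of \<sigma> "\<lambda>\<eta>. \<rho> (\<eta> k)" I] assms(2)
      by simp
  qed
  also have "\<dots> = (\<Sum>\<eta>\<in>?C. \<Sum>\<sigma>\<in>sign_V. \<rho> (\<sigma> * \<eta> k))"
    by (rule sum.swap)
  also have "\<dots> = (\<Sum>\<eta>\<in>?C. sum \<rho> sign_V)"
    using assms(2)
    by (intro sum.cong refl sum.reindex_bij_betw[OF bij_betw_reflect_sign_V]) (auto simp: two_sided_def)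
  finally show ?thesis by (simp add: field_simps)
qed

text \<open>A pattern with a zero sign anywhere has a factor of mass zero.\<close>

lemma one_sided_prob_eq_sum_sign_V:
  fixes p :: "real ^ 'd::finite \<Rightarrow> real"
  assumes "finite I" and "\<And>\<zeta>. \<zeta> \<in> sign_U - sign_V \<Longrightarrow> p \<zeta> = 0"
  shows "one_sided_prob I p =
    (\<Sum>\<eta>\<in>{\<eta> \<in> I \<rightarrow>\<^sub>E sign_V. one_sided I \<eta>}. \<Prod>k\<in>I. p (\<eta> k))"
proof -
  let ?S = "{\<eta> \<in> I \<rightarrow>\<^sub>E sign_V. one_sided I \<eta>} :: ('a \<Rightarrow> real ^ 'd) set"
  show "one_sided_prob I p = (\<Sum>\<eta>\<in>?S. \<Prod>k\<in>I. p (\<eta> k))"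
    unfolding one_sided_prob_def
  proof (rule sum.mono_neutral_right)
    show "\<forall>\<eta>\<in>{\<eta> \<in> I \<rightarrow>\<^sub>E sign_U. one_sided I \<eta>} - ?S. (\<Prod>k\<in>I. p (\<eta> k)) = 0"
    proof
      fix \<eta> assume *: "\<eta> \<in> {\<eta> \<in> I \<rightarrow>\<^sub>E sign_U. one_sided I \<eta>} - ?S"
      then obtain k where "k \<in> I" "\<eta> k \<notin> sign_V" by (auto simp: PiE_iff)
      moreover from this have "p (\<eta> k) = 0" using * assms(2) by (auto simp: PiE_iff)
      ultimately show "(\<Prod>k\<in>I. p (\<eta> k)) = 0" using assms(1) by auto
    qed
  next
    show "?S \<subseteq> {\<eta> \<in> I \<rightarrow>\<^sub>E sign_U. one_sided I \<eta>}"
      using sign_V_subset_sign_U by (auto simp: PiE_iff)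
  qed (use assms(1) in \<open>simp add: finite_PiE\<close>)
qed

lemma one_sided_prob_eq_two_sided:
  fixes p :: "real ^ 'd::finite \<Rightarrow> real"
  assumes "finite I" and "\<And>\<zeta>. \<zeta> \<in> sign_U - sign_V \<Longrightarrow> p \<zeta> = 0" and "sum p sign_V = 1"
  shows "one_sided_prob I p = 1 - (\<Sum>\<eta>\<in>two_sided I. \<Prod>k\<in>I. p (\<eta> k))"
proof -
  let ?S = "{\<eta> \<in> I \<rightarrow>\<^sub>E sign_V. one_sided I \<eta>} :: ('a \<Rightarrow> real ^ 'd) set"
  have "one_sided_prob I p = (\<Sum>\<eta>\<in>?S. \<Prod>k\<in>I. p (\<eta> k))"
    using assms(1,2) by (rule one_sided_prob_eq_sum_sign_V)
  moreover have "(\<Sum>\<eta>\<in>I \<rightarrow>\<^sub>E sign_V. \<Prod>k\<in>I. p (\<eta> k)) = 1"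
    using prod_sum_PiE[of I "\<lambda>_. sign_V" "\<lambda>_. p"] assms by simp
  moreover have "(\<Sum>\<eta>\<in>I \<rightarrow>\<^sub>E sign_V. \<Prod>k\<in>I. p (\<eta> k))
      = (\<Sum>\<eta>\<in>?S. \<Prod>k\<in>I. p (\<eta> k)) + (\<Sum>\<eta>\<in>two_sided I. \<Prod>k\<in>I. p (\<eta> k))"
    using assms(1) unfolding two_sided_def
    by (subst sum.union_disjoint[symmetric]) (auto simp: finite_PiE intro!: sum.cong)
  ultimately show ?thesis by simp
qed

section \<open>Perturbation of the uniform distribution on the orthants\<close>

text \<open>The left side collects the terms of degree at most one in \<open>y\<close> of the
  expanded product; the remaining terms are non-negative.\<close>

lemma prod_add_ge:
  fixes a :: real
  assumes "finite I" and "0 \<le> a" and "\<And>k. k \<in> I \<Longrightarrow> 0 \<le> y k"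
  shows "a ^ card I + (\<Sum>k\<in>I. y k) * a ^ (card I - 1) \<le> (\<Prod>k\<in>I. a + y k)"
  using assms(1,3)
proof (induction I rule: finite_induct)
  case (insert x I)
  let ?s = "\<Sum>k\<in>I. y k" and ?m = "card I"
  have nn: "0 \<le> y x" "0 \<le> ?s" using insert.prems by (auto intro: sum_nonneg)
  \<comment> \<open>For empty \<open>I\<close> the exponent \<open>card I - 1\<close> truncates to
    0, but then the sum is 0 as well.\<close>
  have s: "?s * a ^ ?m = a * (?s * a ^ (?m - 1))"
    using insert.hyps(1) by (cases "I = {}") (auto simp: card_gt_0_iff power_eq_if)
  have "a ^ Suc ?m + (y x + ?s) * a ^ ?m
      \<le> (a + y x) * (a ^ ?m + ?s * a ^ (?m - 1))"
    using nn assms(2) mult_nonneg_nonneg[of "y x" "?s * a ^ (?m - 1)"] by (simp add: algebra_simps s)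
  also have "\<dots> \<le> (a + y x) * (\<Prod>k\<in>I. a + y k)"
    using insert nn assms(2) by (intro mult_left_mono) auto
  finally show ?case using insert.hyps by simp
qed simp

text \<open>The right side is the probability that a binomial variable with parameters
  \<open>b\<close> and \<open>x\<close> is at most 1. Passing from b to b + 1 lowers it by b x^2 (1
  - x)^(b - 1), which is at most b x^2, and these losses add up to b (b - 1) / 2 * x^2.\<close>

lemma binomial_tail_ge:
  fixes x :: real
  assumes "0 \<le> x" "x \<le> 1"
  shows "1 - real b * (real b - 1) / 2 * x\<^sup>2 \<le> (1 - x) ^ b + real b * x * (1 - x) ^ (b - 1)"
proof (induction b)
  case (Suc b)
  have "real b * x * (1 - x) ^ b = (1 - x) * (real b * x * (1 - x) ^ (b - 1))"
    by (cases b) auto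
  moreover have "x * (real b * x * (1 - x) ^ (b - 1)) \<le> x * (real b * x * 1)"
    using assms by (intro mult_left_mono power_le_one) auto
  ultimately have "(1 - x) ^ b + real b * x * (1 - x) ^ (b - 1)
      \<le> (1 - x) ^ Suc b + real (Suc b) * x * (1 - x) ^ b + real b * x\<^sup>2"
    by (simp add: algebra_simps power2_eq_square)
  then show ?case
    using Suc by (simp add: field_simps power2_eq_square)
qed simp

text \<open>On \<open>sign_V\<close>, \<open>p\<close> is a constant part \<open>a\<close> plus a
  remainder \<open>y\<close> of total mass \<open>x\<close>. In the expanded two-sided sum the terms
  with at most one factor \<open>y\<close> are kept. By reflection symmetry they equal those of a
  uniform remainder, which leaves the unbiased two-sided probability times the binomial
  tail.\<close>

lemma one_sided_prob_le:
  fixes p :: "real ^ 'd::finite \<Rightarrow> real"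
  assumes I: "finite I" "I \<noteq> {}"
    and p: "\<And>\<zeta>. \<zeta> \<in> sign_U - sign_V \<Longrightarrow> p \<zeta> = 0" "sum p sign_V = 1"
    and x: "0 \<le> x" "x \<le> 1"
    and ge: "\<And>\<zeta>. \<zeta> \<in> sign_V \<Longrightarrow> (1 - x) / 2 ^ CARD('d) \<le> p \<zeta>"
  shows "one_sided_prob I p \<le> 1 - (1 - 2 / 2 ^ card I) ^ CARD('d) *
    (1 - real (card I) * (real (card I) - 1) / 2 * x\<^sup>2)"
proof -
  let ?C = "two_sided I :: ('a \<Rightarrow> real ^ 'd) set"
  let ?D = "CARD('d)" and ?b = "card I"
  define a where "a = (1 - x) / 2 ^ ?D"
  define y where "y \<zeta> = p \<zeta> - a" for \<zeta>
  have "0 \<le> a" using x by (simp add: a_def)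
  have y: "0 \<le> y \<zeta>" if "\<zeta> \<in> sign_V" for \<zeta> using ge[OF that] by (simp add: y_def a_def)
  have sum_y: "sum y sign_V = x"
    using p(2) by (simp add: y_def a_def sum_subtractf card_sign_V)
  have b: "?b = Suc (?b - 1)" using I by (simp add: card_gt_0_iff)
  have U: "real (card ?C) / (2 ^ ?D) ^ ?b = (1 - 2 / 2 ^ ?b) ^ ?D"
    using card_two_sided[OF I, where 'd = 'd]
    by (simp add: power_mult[symmetric] mult.commute[of ?D] power_divide[symmetric] diff_divide_distrib)
      (simp add: power_mult power_divide[symmetric] diff_divide_distrib)
  have "(1 - 2 / 2 ^ ?b) ^ ?D * (1 - real ?b * (real ?b - 1) / 2 * x\<^sup>2)
      \<le> (1 - 2 / 2 ^ ?b) ^ ?D * ((1 - x) ^ ?b + real ?b * x * (1 - x) ^ (?b - 1))"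
    using self_le_power[of "2::real" ?b] b
    by (intro mult_left_mono binomial_tail_ge x zero_le_power) (auto simp: field_simps)
  also have "\<dots> = real (card ?C) * (a ^ ?b + real ?b * (x / 2 ^ ?D) * a ^ (?b - 1))"
  proof -
    have "(2 ^ ?D :: real) ^ ?b = 2 ^ ?D * (2 ^ ?D) ^ (?b - 1)"
      by (subst b) simp
    then show ?thesis
      unfolding U[symmetric] a_def power_divide by (simp add: field_simps)
  qed
  \<comment> \<open>Each of the \<open>?b\<close> linear terms depends on \<open>y\<close> only
    through its total mass \<open>x\<close>, by \<open>sum_two_sided_component\<close>.\<close>
  also have "\<dots> = (\<Sum>\<eta>\<in>?C. a ^ ?b + (\<Sum>k\<in>I. y (\<eta> k)) * a ^ (?b - 1))"
    by (simp add: sum.distrib sum_distrib_right[symmetric] sum.swap[of _ I]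
        sum_two_sided_component[OF I(1)] sum_y)
      (simp add: algebra_simps)
  also have "\<dots> \<le> (\<Sum>\<eta>\<in>?C. \<Prod>k\<in>I. a + y (\<eta> k))"
    using I \<open>0 \<le> a\<close> y by (intro sum_mono prod_add_ge) (auto simp: two_sided_def PiE_iff)
  also have "\<dots> = 1 - one_sided_prob I p"
    using one_sided_prob_eq_two_sided[OF I(1), of p] p by (simp add: y_def)
  finally show ?thesis by simp
qed

text \<open>In dimension one the mixture bound above is too weak by a factor of up to two.\<close>

lemma sum_powers_le:
  fixes p q \<delta> :: real
  assumes "p + q = 1" "0 \<le> p" "0 \<le> q" "\<bar>p - q\<bar> \<le> 2 * \<delta>" "1 \<le> b"
  shows "p ^ b + q ^ b \<le> 2 / 2 ^ b + real b * (real b - 1) * \<delta>\<^sup>2"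
  using assms(5)
proof (induction b rule: dec_induct)
  case base
  then show ?case using assms(1) by simp
next
  case (step n)
  \<comment> \<open>Factoring \<open>p - q\<close> out of the difference of powers leaves
    \<open>n\<close> products of powers of \<open>p\<close> and \<open>q\<close>, each at most
    1.\<close>
  have "(p - q) * (p ^ n - q ^ n) \<le> 4 * real n * \<delta>\<^sup>2"
  proof -
    have "p \<le> 1" "q \<le> 1" using assms(1-3) by auto
    then have "(\<Sum>i<n. p ^ i * q ^ (n - Suc i)) \<le> (\<Sum>i<n. 1)"
      using assms by (intro sum_mono mult_le_one power_le_one) auto
    moreover have "(p - q)\<^sup>2 \<le> (2 * \<delta>)\<^sup>2"
      using power_mono[OF assms(4), of 2] by simp
    ultimately have "(p - q)\<^sup>2 * (\<Sum>i<n. p ^ i * q ^ (n - Suc i)) \<le> (2 * \<delta>)\<^sup>2 * n"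
      using assms by (intro mult_mono) (auto intro!: sum_nonneg)
    then show ?thesis
      using power_diff_sumr2[of p n q] by (simp add: power2_eq_square mult_ac)
  qed
  \<comment> \<open>Since \<open>p + q = 1\<close>, the power sum halves at each step up to the
    product just estimated.\<close>
  moreover have "p ^ Suc n + q ^ Suc n = (p ^ n + q ^ n) / 2 + (p - q) * (p ^ n - q ^ n) / 2"
  proof -
    have "p ^ Suc n + q ^ Suc n = (p + q) * (p ^ n + q ^ n) / 2 + (p - q) * (p ^ n - q ^ n) / 2"
      by (simp add: field_simps)
    then show ?thesis unfolding assms(1) by simp
  qed
  ultimately have "p ^ Suc n + q ^ Suc n
      \<le> (2 / 2 ^ n + real n * (real n - 1) * \<delta>\<^sup>2) / 2 + 4 * real n * \<delta>\<^sup>2 / 2"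
    using step.IH by (simp only: add_mono divide_right_mono zero_le_numeral)
  also have "\<dots> = 2 / 2 ^ Suc n + real (Suc n) * (real (Suc n) - 1) * \<delta>\<^sup>2
      - real n * (real n - 1) / 2 * \<delta>\<^sup>2"
    by (simp add: field_simps)
  also have "\<dots> \<le> 2 / 2 ^ Suc n + real (Suc n) * (real (Suc n) - 1) * \<delta>\<^sup>2"
    using step by simp
  finally show ?case .
qed

text \<open>With t = 2 / 2^b, the chance that b fair signs agree, the alternating sum is minus the
  binomial expansion of (1 - t)^d without its constant term. So \<open>hull_U b d\<close> is the
  miss probability in the unbiased case.\<close>

lemma hull_U_closed_form:
  assumes "1 \<le> b" and "1 \<le> d"
  shows "hull_U b d = 1 - (1 - 2 / 2 ^ b) ^ d"
proof -
  let ?t = "2 / 2 ^ b :: real"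
  have "(1 - ?t) ^ d = (\<Sum>j\<le>d. real (d choose j) * (- ?t) ^ j)"
    using binomial_ring[of "- ?t" 1 d] by simp
  also have "\<dots> = 1 + (\<Sum>j=1..d. real (d choose j) * (- ?t) ^ j)"
    by (simp add: atMost_atLeast0 sum.atLeast_Suc_atMost)
  also have "(\<Sum>j=1..d. real (d choose j) * (- ?t) ^ j) = - hull_U b d"
    unfolding hull_U_def sum_negf[symmetric]
  proof (rule sum.cong[OF refl])
    fix j assume "j \<in> {1..d}"
    then have "(- 1 :: real) ^ j = - ((- 1) ^ (j - 1))"
      by (cases j) auto
    moreover have "(- ?t) ^ j = (- 1) ^ j * (2 ^ j * (1 / 2 ^ j) ^ b)"
      by (subst power_minus) (simp add: power_divide power_mult[symmetric] mult.commute)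
    ultimately show "real (d choose j) * (- ?t) ^ j
        = - ((- 1) ^ (j - 1) * real (d choose j) * 2 ^ j * (1 / 2 ^ j) ^ b)"
      by simp
  qed
  finally show ?thesis by simp
qed

section \<open>Orthant median bias\<close>

lemma sign_vec_measurable [measurable]: "(sign_vec :: real ^ 'd::finite \<Rightarrow> _) \<in> borel_measurable borel"
  unfolding sign_vec_def
  by (intro borel_measurable_euclidean_space[THEN iffD2]) (auto simp: Basis_vec_def inner_axis)

lemma sets_sign_vec_eq [measurable]: "{x :: real ^ 'd::finite. sign_vec x = \<eta>} \<in> sets borel"
proof -
  have "sign_vec -` {\<eta>} \<inter> space borel \<in> sets (borel :: (real ^ 'd) measure)"
    by measurable
  then show ?thesis by (simp add: vimage_def)
qed

lemma space_prob_algebra_borelD: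
  assumes "\<mu> \<in> space (prob_algebra borel)"
  shows "prob_space \<mu>" "sets \<mu> = sets borel" "space \<mu> = UNIV"
  using assms by (auto simp: space_prob_algebra dest: sets_eq_imp_space_eq)

lemma sum_sgn_mass:
  fixes \<mu> :: "(real ^ 'd::finite) measure"
  assumes "\<mu> \<in> space (prob_algebra borel)" and "F \<subseteq> sign_U"
  shows "(\<Sum>\<zeta>\<in>F. sgn_mass \<mu> \<zeta>) = measure \<mu> {x. sign_vec x \<in> F}"
proof -
  interpret prob_space \<mu> using assms by (simp add: space_prob_algebra)
  have "finite F" using assms(2) finite_subset by fastforce
  have "{x. sign_vec x \<in> F} = (\<Union>\<zeta>\<in>F. {x. sign_vec x = \<zeta>})" by auto
  moreover have "measure \<mu> \<dots> = (\<Sum>\<zeta>\<in>F. measure \<mu> {x. sign_vec x = \<zeta>})"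
    using space_prob_algebra_borelD[OF assms(1)] \<open>finite F\<close>
    by (intro finite_measure_finite_Union) (auto simp: disjoint_family_on_def)
  ultimately show ?thesis by (simp add: sgn_mass_def)
qed

lemma sign_vec_in_sign_V_iff: "sign_vec x \<in> sign_V \<longleftrightarrow> (\<forall>j. x $ j \<noteq> 0)"
proof -
  have "sgn t \<in> {-1, 1} \<longleftrightarrow> t \<noteq> 0" for t :: real
    by (auto simp: sgn_if)
  then show ?thesis
    unfolding sign_V_def sign_vec_def by (simp del: insert_iff)
qed

text \<open>The points with a zero coordinate form a finite disjoint union of sign classes, so the
  null condition can be read off the masses.\<close>

lemma MCH_iff:
  fixes \<nu> :: "(real ^ 'd::finite) measure"
  shows "\<nu> \<in> MCH \<longleftrightarrow> \<nu> \<in> space (prob_algebra borel) \<and> (\<forall>\<zeta>\<in>sign_U - sign_V. sgn_mass \<nu> \<zeta> = 0)"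
proof (cases "\<nu> \<in> space (prob_algebra borel)")
  case True
  have "{x :: real ^ 'd. \<exists>j. x $ j = 0} = {x. sign_vec x \<in> sign_U - sign_V}"
    by (auto simp: sign_vec_in_sign_U sign_vec_in_sign_V_iff)
  then have "measure \<nu> {x. \<exists>j. x $ j = 0} = (\<Sum>\<zeta>\<in>sign_U - sign_V. sgn_mass \<nu> \<zeta>)"
    using sum_sgn_mass[OF True, of "sign_U - sign_V"] by simp
  also have "\<dots> = 0 \<longleftrightarrow> (\<forall>\<zeta>\<in>sign_U - sign_V. sgn_mass \<nu> \<zeta> = 0)"
    by (intro sum_nonneg_eq_0_iff) (auto simp: sgn_mass_def)
  finally show ?thesis using True by (simp add: MCH_def)
qed (simp add: MCH_def)

lemma sum_sgn_mass_MCH: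
  fixes \<nu> :: "(real ^ 'd::finite) measure"
  assumes "\<nu> \<in> MCH"
  shows "(\<Sum>\<zeta>\<in>sign_V. sgn_mass \<nu> \<zeta>) = 1"
proof -
  have \<nu>: "\<nu> \<in> space (prob_algebra borel)" "\<forall>\<zeta>\<in>sign_U - sign_V. sgn_mass \<nu> \<zeta> = 0"
    using assms by (auto simp: MCH_iff)
  have "(\<Sum>\<zeta>\<in>sign_V. sgn_mass \<nu> \<zeta>) = (\<Sum>\<zeta>\<in>sign_U. sgn_mass \<nu> \<zeta>)"
    using \<nu>(2) sign_V_subset_sign_U by (intro sum.mono_neutral_left) auto
  also have "\<dots> = 1"
    using sum_sgn_mass[OF \<nu>(1), of sign_U] space_prob_algebra_borelD[OF \<nu>(1)]
    by (simp add: sign_vec_in_sign_U prob_space.prob_space[of \<nu>, simplified])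
      (metis prob_space.prob_space)
  finally show ?thesis .
qed

text \<open>Guarantees that the infimum in \<open>OMB\<close> is over a non-empty set. The sign
  classes with a zero entry are emptied one after another; \<open>Z\<close> holds those already
  emptied.\<close>

lemma ex_MCH_above:
  fixes \<mu> :: "(real ^ 'd::finite) measure"
  assumes "\<mu> \<in> space (prob_algebra borel)"
  shows "\<exists>\<nu>\<in>MCH. \<mu> \<preceq>\<^sub>M\<^sub>C\<^sub>H \<nu>"
proof -
  have "\<exists>\<nu>\<in>space (prob_algebra borel). \<mu> \<preceq>\<^sub>M\<^sub>C\<^sub>H \<nu> \<and> (\<forall>\<zeta>\<in>Z. sgn_mass \<nu> \<zeta> = 0)"
    if "finite Z" "Z \<subseteq> sign_U - sign_V" for Z
    using that
  proof (induction Z rule: finite_induct)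
    case empty
    then show ?case using assms by (auto simp: mch_le_def)
  next
    case (insert \<eta> Z)
    then obtain \<nu> where \<nu>: "\<nu> \<in> space (prob_algebra borel)" "\<mu> \<preceq>\<^sub>M\<^sub>C\<^sub>H \<nu>"
      and zero: "\<And>\<zeta>. \<zeta> \<in> Z \<Longrightarrow> sgn_mass \<nu> \<zeta> = 0"
      by auto
    note \<nu>' = space_prob_algebra_borelD[OF \<nu>(1)]
    interpret prob_space \<nu> by fact
    \<comment> \<open>Filling the zeros of \<open>\<eta>\<close> with 1 gives a zero-free pattern
      above \<open>\<eta>\<close> that is its own sign vector. The map \<open>g\<close> then
      collapses the class of \<open>\<eta>\<close> to the point \<open>c\<close>.\<close>
    define c :: "real ^ 'd" where "c = (\<chi> j. if \<eta> $ j = 0 then 1 else \<eta> $ j)"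
    define g where "g x = (if sign_vec x = \<eta> then c else x)" for x :: "real ^ 'd"
    define \<kappa> where "\<kappa> = distr \<nu> borel g"
    have \<eta>: "\<eta> \<in> sign_U" "\<eta> \<notin> sign_V" using insert.prems by auto
    have c: "c \<in> sign_V" "\<eta> \<preceq>\<^sub>s c" "sign_vec c = c"
      using \<eta>(1) by (auto simp: c_def sign_U_def sign_V_def sign_le_def sign_vec_def vec_eq_iff)
        (metis sgn_1 sgn_minus)+
    have "c \<noteq> \<eta>" using c \<eta> by auto
    have [measurable]: "g \<in> borel_measurable borel"
      unfolding g_def by measurable
    then have g: "g \<in> measurable \<nu> borel"
      using \<nu>'(2) by (simp cong: measurable_cong_sets)
    have \<kappa>: "\<kappa> \<in> space (prob_algebra borel)"
      using g by (simp add: \<kappa>_def space_prob_algebra prob_space_distr)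
    have mass: "sgn_mass \<kappa> \<gamma> = measure \<nu> {x. sign_vec (g x) = \<gamma>}" for \<gamma>
      using g \<nu>'(3) by (simp add: sgn_mass_def \<kappa>_def measure_distr vimage_def)
    have "{x. sign_vec (g x) = \<eta>} = {}"
      using \<open>c \<noteq> \<eta>\<close> c(3) by (auto simp: g_def)
    then have mass_\<eta>: "sgn_mass \<kappa> \<eta> = 0" by (simp only: mass) simp
    have mass_other: "sgn_mass \<kappa> \<gamma> = sgn_mass \<nu> \<gamma>" if "\<gamma> \<noteq> \<eta>" "\<gamma> \<noteq> c" for \<gamma>
      unfolding mass unfolding sgn_mass_def using that c(3)
      by (intro arg_cong[where f = "measure \<nu>"]) (auto simp: g_def)
    have "{x. sign_vec (g x) = c} = {x. sign_vec x = c} \<union> {x. sign_vec x = \<eta>}"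
      using c(3) by (auto simp: g_def)
    moreover have "measure \<nu> ({x. sign_vec x = c} \<union> {x. sign_vec x = \<eta>}) = sgn_mass \<nu> c + sgn_mass \<nu> \<eta>"
      unfolding sgn_mass_def using \<nu>'(2) \<open>c \<noteq> \<eta>\<close> by (intro finite_measure_Union) auto
    ultimately have mass_c: "sgn_mass \<kappa> c = sgn_mass \<nu> c + sgn_mass \<nu> \<eta>"
      by (simp add: mass)
    have "elementary_op \<nu> \<kappa>"
      unfolding elementary_op_def
    proof (intro conjI \<nu>(1) \<kappa>, rule exI[of _ "sgn_mass \<nu> \<eta>"], intro conjI,
        goal_cases nonneg ops)
      case ops
      show ?case
        by (rule bexI[of _ \<eta>], rule bexI[of _ c])
          (use \<eta> c sign_V_subset_sign_U mass_\<eta> mass_c mass_other in auto)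
    qed (simp add: sgn_mass_def)
    then have "\<mu> \<preceq>\<^sub>M\<^sub>C\<^sub>H \<kappa>" using \<nu>(2) by (simp add: mch_le_def)
    \<comment> \<open>Classes emptied earlier stay empty, because the receiving class
      \<open>c\<close> is zero-free and so not in \<open>Z\<close>.\<close>
    moreover have "sgn_mass \<kappa> \<zeta> = 0" if "\<zeta> \<in> insert \<eta> Z" for \<zeta>
    proof (cases "\<zeta> = \<eta>")
      case False
      then have "\<zeta> \<in> Z" using that by simp
      moreover from this have "\<zeta> \<noteq> c" using insert.prems c(1) by blast
      ultimately show ?thesis using False mass_other zero by simp
    qed (simp add: mass_\<eta>)
    ultimately show ?case using \<kappa> by blast
  qed
  from this[of "sign_U - sign_V"] show ?thesis
    by (auto simp: MCH_iff)
qed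

text \<open>The infimum need not be attained, hence the strict hypothesis. The rest is scaling:
  2^(d-1) * (1 / 2^d - m) < \<delta> says that the mass m exceeds (1 - 2 \<delta>) / 2^d.\<close>

lemma OMB_less_obtain:
  fixes \<mu> :: "(real ^ 'd::finite) measure"
  assumes "\<mu> \<in> space (prob_algebra borel)" and "OMB \<mu> < \<delta>"
  obtains \<nu> where "\<nu> \<in> MCH" "\<mu> \<preceq>\<^sub>M\<^sub>C\<^sub>H \<nu>" "0 < \<delta>"
    "\<And>\<zeta>. \<zeta> \<in> sign_V \<Longrightarrow> (1 - 2 * \<delta>) / 2 ^ CARD('d) \<le> sgn_mass \<nu> \<zeta>"
proof -
  let ?A = "{\<nu> \<in> MCH. \<mu> \<preceq>\<^sub>M\<^sub>C\<^sub>H \<nu>}"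
  let ?v = "\<lambda>\<nu> :: (real ^ 'd) measure.
    2 ^ (CARD('d) - 1) * max (1 / 2 ^ CARD('d) - Min (sgn_mass \<nu> ` sign_V)) 0 :: real"
  have "bdd_below (?v ` ?A)" by (intro bdd_belowI2[where m = 0]) simp
  moreover have "?A \<noteq> {}" using ex_MCH_above[OF assms(1)] by auto
  ultimately obtain \<nu> where \<nu>: "\<nu> \<in> ?A" "?v \<nu> < \<delta>"
    using assms(2) unfolding OMB_def by (auto simp: cINF_less_iff)
  have D: "(2::real) ^ CARD('d) = 2 * 2 ^ (CARD('d) - 1)"
    by (simp add: power_eq_if)
  have "(1 - 2 * \<delta>) / 2 ^ CARD('d) \<le> sgn_mass \<nu> \<zeta>" if "\<zeta> \<in> sign_V" for \<zeta>
  proof -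
    have "Min (sgn_mass \<nu> ` sign_V) \<le> sgn_mass \<nu> \<zeta>" using that by (intro Min_le) auto
    then have "1 / 2 ^ CARD('d) - sgn_mass \<nu> \<zeta> \<le> max (1 / 2 ^ CARD('d) - Min (sgn_mass \<nu> ` sign_V)) 0"
      by simp
    then have "2 ^ (CARD('d) - 1) * (1 / 2 ^ CARD('d) - sgn_mass \<nu> \<zeta>) \<le> ?v \<nu>"
      by (intro mult_left_mono) auto
    also note \<nu>(2)
    finally have "2 ^ (CARD('d) - 1) * (1 / 2 ^ CARD('d)) - 2 ^ (CARD('d) - 1) * sgn_mass \<nu> \<zeta> < \<delta>"
      by (simp only: right_diff_distrib)
    moreover have "2 ^ (CARD('d) - 1) * (1 / 2 ^ CARD('d)) = (1 / 2 :: real)"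
      unfolding D by simp
    ultimately have "1 - 2 * \<delta> \<le> sgn_mass \<nu> \<zeta> * 2 ^ CARD('d)"
      unfolding D by (simp add: mult_ac)
    then show ?thesis by (simp add: divide_le_eq)
  qed
  moreover have "0 < \<delta>"
    using \<nu>(2) by (rule le_less_trans[rotated]) simp
  ultimately show ?thesis using \<nu>(1) that by blast
qed

section \<open>One-sided probability in terms of the bias\<close>

lemma sign_V_dim_one:
  assumes "CARD('d::finite) = 1"
  shows "(sign_V :: (real ^ 'd) set) = {1, -1}"
proof -
  obtain i :: 'd where "UNIV = {i}" using assms by (auto simp: card_1_singleton_iff)
  then have all: "j = i" for j by (metis UNIV_I singletonD)
  have "x \<in> sign_V \<longleftrightarrow> x $ i = -1 \<or> x $ i = 1" "x = 1 \<longleftrightarrow> x $ i = 1" "x = -1 \<longleftrightarrow> x $ i = -1"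
    for x :: "real ^ 'd"
    unfolding sign_V_def vec_eq_iff by (auto, (metis all)+)
  then show ?thesis by blast
qed

text \<open>For d >= 2 the mixture bound with x = 2 \<delta> costs at most 2 b (b - 1) \<delta>^2,
  and 2 <= 2^(d-1). If 2 \<delta> exceeds 1, the claimed bound is itself at least 1. Dimension one
  goes through \<open>sum_powers_le\<close>.\<close>

lemma one_sided_prob_MCH_le:
  fixes \<nu> :: "(real ^ 'd::finite) measure"
  assumes \<nu>: "\<nu> \<in> MCH" and "0 < \<delta>" and b: "1 \<le> b"
    and ge: "\<And>\<zeta>. \<zeta> \<in> sign_V \<Longrightarrow> (1 - 2 * \<delta>) / 2 ^ CARD('d) \<le> sgn_mass \<nu> \<zeta>"
  shows "one_sided_prob {1..b} (sgn_mass \<nu>)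
    \<le> hull_U b CARD('d) + 2 ^ (CARD('d) - 1) * real b * (real b - 1) * \<delta>\<^sup>2"
proof -
  let ?D = "CARD('d)" and ?p = "sgn_mass \<nu>"
  have zero: "\<And>\<zeta>. \<zeta> \<in> sign_U - sign_V \<Longrightarrow> ?p \<zeta> = 0"
    using \<nu> by (auto simp: MCH_iff)
  note one = sum_sgn_mass_MCH[OF \<nu>]
  have D: "1 \<le> ?D" by (simp add: Suc_leI)
  note U = hull_U_closed_form[OF b D]
  have t: "(2::real) \<le> 2 ^ b" using self_le_power[of "2::real" b] b by simp
  consider "?D = 1" | "2 \<le> ?D" using D by linarith
  then show ?thesis
  proof cases
    assume D1: "?D = 1"
    obtain i :: 'd where i: "UNIV = {i}" using D1 by (auto simp: card_1_singleton_iff)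
    have ne: "(1 :: real ^ 'd) \<noteq> -1" by (simp add: vec_eq_iff)
    \<comment> \<open>With a single coordinate, a one-sided pattern is constant.\<close>
    have S: "{\<eta> \<in> {1..b} \<rightarrow>\<^sub>E sign_V. one_sided {1..b} \<eta>} \<subseteq> {\<lambda>k\<in>{1..b}. (1 :: real ^ 'd), \<lambda>k\<in>{1..b}. -1}"
    proof
      fix \<eta> :: "nat \<Rightarrow> real ^ 'd" assume "\<eta> \<in> {\<eta> \<in> {1..b} \<rightarrow>\<^sub>E sign_V. one_sided {1..b} \<eta>}"
      then obtain j s where "s \<in> {1, -1}" "\<forall>k\<in>{1..b}. \<eta> k $ j = s" "\<eta> \<in> extensional {1..b}"
        unfolding one_sided_def PiE_iff by blast
      moreover have "x = y" if "x $ j = y $ j" for x y :: "real ^ 'd"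
        using that i by (auto simp: vec_eq_iff) (metis UNIV_I singletonD)
      ultimately have "\<eta> = (\<lambda>k\<in>{1..b}. 1) \<or> \<eta> = (\<lambda>k\<in>{1..b}. -1)"
        by (auto simp: fun_eq_iff extensional_def)
      then show "\<eta> \<in> {\<lambda>k\<in>{1..b}. 1, \<lambda>k\<in>{1..b}. -1}" by simp
    qed
    have "one_sided_prob {1..b} ?p \<le> ?p 1 ^ b + ?p (-1) ^ b"
    proof -
      have "one_sided_prob {1..b} ?p
          = (\<Sum>\<eta>\<in>{\<eta> \<in> {1..b} \<rightarrow>\<^sub>E sign_V. one_sided {1..b} \<eta>}. \<Prod>k\<in>{1..b}. ?p (\<eta> k))"
        using zero by (intro one_sided_prob_eq_sum_sign_V) auto
      also have "\<dots> \<le> (\<Sum>\<eta>\<in>{\<lambda>k\<in>{1..b}. 1, \<lambda>k\<in>{1..b}. -1}. \<Prod>k\<in>{1..b}. ?p (\<eta> k))"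
        using S by (intro sum_mono2) (auto intro!: prod_nonneg simp: sgn_mass_def)
      also have "\<dots> \<le> (\<Prod>k\<in>{1..b}. ?p 1) + (\<Prod>k\<in>{1..b}. ?p (-1))"
        by (subst sum.insert_if) (auto intro!: prod_nonneg simp: sgn_mass_def)
      finally show ?thesis by simp
    qed
    moreover have nonneg: "0 \<le> ?p \<zeta>" for \<zeta> by (simp add: sgn_mass_def)
    moreover have sum1: "?p 1 + ?p (-1) = 1" using one ne by (simp add: sign_V_dim_one[OF D1])
    \<comment> \<open>Both masses are at least 1/2 - \<delta> and they add up to 1.\<close>
    moreover have "\<bar>?p 1 - ?p (-1)\<bar> \<le> 2 * \<delta>"
      using ge[of 1] ge[of "-1"] sum1 by (auto simp: sign_V_dim_one[OF D1] D1)
    ultimately show ?thesis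
      using sum_powers_le[of "?p 1" "?p (-1)" \<delta> b] b nonneg unfolding U unfolding D1
      by simp
  next
    assume D2: "2 \<le> ?D"
    have two: "2 \<le> (2::real) ^ (?D - 1)"
      using self_le_power[of "2::real" "?D - 1"] D2 by simp
    let ?r = "real b * (real b - 1)"
    have r: "0 \<le> ?r" using b by simp
    have q: "0 \<le> (1 - 2 / 2 ^ b :: real) ^ ?D" "(1 - 2 / 2 ^ b :: real) ^ ?D \<le> 1"
      using t by (auto intro!: zero_le_power power_le_one simp: field_simps)
    have le: "2 * (?r * \<delta>\<^sup>2) \<le> 2 ^ (?D - 1) * (?r * \<delta>\<^sup>2)"
      using r by (intro mult_right_mono two) auto
    show ?thesis
    proof (cases "2 * \<delta> \<le> 1")
      case True
      have "one_sided_prob {1..b} ?p \<le> 1 - (1 - 2 / 2 ^ b) ^ ?D * (1 - ?r / 2 * (2 * \<delta>)\<^sup>2)"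
        using one_sided_prob_le[of "{1..b}" ?p "2 * \<delta>"] zero one ge True \<open>0 < \<delta>\<close> b by simp
      also have "\<dots> = hull_U b ?D + (1 - 2 / 2 ^ b) ^ ?D * (2 * (?r * \<delta>\<^sup>2))"
        unfolding U by (simp add: field_simps power2_eq_square)
      also have "\<dots> \<le> hull_U b ?D + 2 * (?r * \<delta>\<^sup>2)"
        using q r mult_right_mono[OF q(2), of "2 * (?r * \<delta>\<^sup>2)"] by simp
      finally show ?thesis using le by (simp add: mult_ac)
    next
      case False
      have "one_sided_prob {1..b} ?p \<le> 1"
        using one_sided_prob_eq_two_sided[of "{1..b}" ?p] zero one
        by (simp add: sum_nonneg prod_nonneg sgn_mass_def)
      show ?thesis
      \<comment> \<open>One batch misses surely in the unbiased case, as
        \<open>hull_U 1 d = 1\<close>. From two batches on, \<delta> > 1/2 makes the bias term at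
        least 1.\<close>
      proof (cases "b = 1")
        case True
        then show ?thesis using \<open>one_sided_prob {1..b} ?p \<le> 1\<close> U D by (simp add: power_0_left)
      next
        case False
        then have "2 * 1 \<le> ?r" using b by (intro mult_mono) auto
        moreover have "1 / 4 \<le> \<delta>\<^sup>2"
          using \<open>\<not> 2 * \<delta> \<le> 1\<close> power_mono[of "1/2" \<delta> 2] by (simp add: power2_eq_square)
        ultimately have "2 * (1 / 4) \<le> ?r * \<delta>\<^sup>2" by (intro mult_mono) auto
        then have "1 \<le> 2 * (?r * \<delta>\<^sup>2)" by simp
        moreover have "0 \<le> hull_U b ?D" using q U by simp
        ultimately show ?thesis using le \<open>one_sided_prob {1..b} ?p \<le> 1\<close> by (simp add: mult_ac)
      qed
    qed
  qed
qed

text \<open>Every \<epsilon> > \<delta> admits a suitable law in \<open>MCH\<close>; the bound is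
  continuous in \<epsilon>, so \<epsilon> may decrease to \<delta>.\<close>

lemma one_sided_prob_le_of_OMB:
  fixes \<mu> :: "(real ^ 'd::finite) measure"
  assumes "\<mu> \<in> space (prob_algebra borel)" and "OMB \<mu> \<le> \<delta>" and "1 \<le> b"
  shows "one_sided_prob {1..b} (sgn_mass \<mu>)
    \<le> hull_U b CARD('d) + 2 ^ (CARD('d) - 1) * real b * (real b - 1) * \<delta>\<^sup>2"
proof -
  let ?f = "\<lambda>\<delta>. hull_U b CARD('d) + 2 ^ (CARD('d) - 1) * real b * (real b - 1) * \<delta>\<^sup>2"
  have "one_sided_prob {1..b} (sgn_mass \<mu>) \<le> ?f \<epsilon>" if "\<delta> < \<epsilon>" for \<epsilon>
  proof -
    from that assms(2) have "OMB \<mu> < \<epsilon>" by simp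
    from OMB_less_obtain[OF assms(1) this] obtain \<nu> where
      \<nu>: "\<nu> \<in> MCH" "\<mu> \<preceq>\<^sub>M\<^sub>C\<^sub>H \<nu>" "0 < \<epsilon>"
        "\<And>\<zeta>. \<zeta> \<in> sign_V \<Longrightarrow> (1 - 2 * \<epsilon>) / 2 ^ CARD('d) \<le> sgn_mass \<nu> \<zeta>"
      by blast
    have "one_sided_prob {1..b} (sgn_mass \<mu>) \<le> one_sided_prob {1..b} (sgn_mass \<nu>)"
      using \<nu>(2) by (intro one_sided_prob_mono) auto
    also have "\<dots> \<le> ?f \<epsilon>" using one_sided_prob_MCH_le[OF \<nu>(1,3) assms(3) \<nu>(4)] .
    finally show ?thesis .
  qed
  moreover have "(?f \<longlongrightarrow> ?f \<delta>) (at_right \<delta>)"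
    by (intro tendsto_intros)
  ultimately show ?thesis
    by (intro tendsto_lowerbound[where F = "at_right \<delta>"])
      (auto simp: eventually_at_right_less intro: eventually_at_rightI[of _ "\<delta> + 1"])
qed

text \<open>The event is a disjoint union of events prescribing the sign vector of every
  \<open>Y k\<close>, and independence factorises each of these.\<close>

lemma (in prob_space) prob_one_sided:
  fixes Y :: "'i \<Rightarrow> 'a \<Rightarrow> real ^ 'd::finite"
  assumes I: "finite I" "I \<noteq> {}" and indep: "indep_vars (\<lambda>_. borel) Y I"
    and law: "\<And>k. k \<in> I \<Longrightarrow> distr M borel (Y k) = L"
  shows "prob {\<omega> \<in> space M. one_sided I (\<lambda>k. sign_vec (Y k \<omega>))} = one_sided_prob I (sgn_mass L)"
proof -
  have [measurable]: "Y k \<in> borel_measurable M" if "k \<in> I" for k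
    using indep that by (auto simp: indep_vars_def)
  let ?E = "{\<eta> \<in> I \<rightarrow>\<^sub>E sign_U. one_sided I \<eta>} :: ('i \<Rightarrow> real ^ 'd) set"
  let ?A = "\<lambda>\<eta>. \<Inter>k\<in>I. Y k -` {x. sign_vec x = \<eta> k} \<inter> space M"
  have "{\<omega> \<in> space M. one_sided I (\<lambda>k. sign_vec (Y k \<omega>))} = (\<Union>\<eta>\<in>?E. ?A \<eta>)"
  proof safe
    fix \<omega> assume *: "\<omega> \<in> space M" "one_sided I (\<lambda>k. sign_vec (Y k \<omega>))"
    let ?\<eta> = "\<lambda>k\<in>I. sign_vec (Y k \<omega>)"
    have "one_sided I ?\<eta>" using *(2) by (simp add: one_sided_def)
    then have "?\<eta> \<in> ?E" by (auto simp: sign_vec_in_sign_U)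
    moreover have "\<omega> \<in> ?A ?\<eta>" using * by auto
    ultimately show "\<omega> \<in> (\<Union>\<eta>\<in>?E. ?A \<eta>)" by blast
  next
    fix \<omega> \<eta> assume *: "one_sided I \<eta>" "\<omega> \<in> ?A \<eta>"
    show "\<omega> \<in> space M" using * I by auto
    have "sign_vec (Y k \<omega>) = \<eta> k" if "k \<in> I" for k using *(2) that by blast
    then show "one_sided I (\<lambda>k. sign_vec (Y k \<omega>))"
      using *(1) by (simp add: one_sided_def)
  qed
  moreover have "prob (\<Union>\<eta>\<in>?E. ?A \<eta>) = (\<Sum>\<eta>\<in>?E. prob (?A \<eta>))"
  proof (rule finite_measure_finite_Union)
    show "disjoint_family_on ?A ?E"
      unfolding disjoint_family_on_def
    proof (intro ballI impI)
      fix \<eta> \<eta>' assume *: "\<eta> \<in> ?E" "\<eta>' \<in> ?E" "\<eta> \<noteq> \<eta>'"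
      then obtain k where "k \<in> I" "\<eta> k \<noteq> \<eta>' k" by (metis (no_types, lifting) PiE_ext mem_Collect_eq)
      then show "?A \<eta> \<inter> ?A \<eta>' = {}" by auto
    qed
  next
    show "?A ` ?E \<subseteq> events"
      using I by (auto intro!: sets.finite_INT measurable_sets)
  qed (use I in \<open>auto simp: finite_PiE\<close>)
  moreover have "prob (?A \<eta>) = (\<Prod>k\<in>I. sgn_mass L (\<eta> k))" for \<eta>
  proof -
    have "prob (?A \<eta>) = (\<Prod>k\<in>I. prob (Y k -` {x. sign_vec x = \<eta> k} \<inter> space M))"
      using I by (intro indep_varsD[OF indep]) auto
    also have "\<dots> = (\<Prod>k\<in>I. sgn_mass L (\<eta> k))"
      by (intro prod.cong refl) (simp add: sgn_mass_def law[symmetric] measure_distr)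
    finally show ?thesis .
  qed
  ultimately show ?thesis by (simp add: one_sided_prob_def)
qed

text \<open>A coordinate outside the closed interval has all estimates strictly on one side of it; a
  tie gives sign 0 and counts as covered. \<open>1 \<le> b\<close> keeps \<open>Min\<close> and
  \<open>Max\<close> on non-empty sets.\<close>

lemma not_in_rect_hull_iff:
  fixes t :: "nat \<Rightarrow> real ^ 'd::finite"
  assumes "1 \<le> b"
  shows "\<theta> \<notin> rect_hull b t \<longleftrightarrow> one_sided {1..b} (\<lambda>k. sign_vec (t k - \<theta>))"
proof -
  have ne: "(\<lambda>k. t k $ j) ` {1..b} \<noteq> {}" for j using assms by auto
  have "\<theta> \<notin> rect_hull b t \<longleftrightarrow>
      (\<exists>j. (\<forall>k\<in>{1..b}. \<theta> $ j < t k $ j) \<or> (\<forall>k\<in>{1..b}. t k $ j < \<theta> $ j))"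
    unfolding rect_hull_def using ne by (simp add: not_le)
  also have "\<dots> \<longleftrightarrow> one_sided {1..b} (\<lambda>k. sign_vec (t k - \<theta>))"
    by (simp add: one_sided_def sign_vec_def sgn_1_pos sgn_1_neg)
  finally show ?thesis .
qed

section \<open>Estimators on disjoint batches\<close>

text \<open>The common law of all batch estimators of size \<open>m\<close>, whichever observations
  make up the batch.\<close>

definition batch_law :: "'x measure \<Rightarrow> ('x list \<Rightarrow> real ^ 'd::finite) \<Rightarrow> nat \<Rightarrow> (real ^ 'd) measure" where
  "batch_law P A m = distr (Pi\<^sub>M {0..<m} (\<lambda>_. P)) borel (\<lambda>x. A (map x [0..<m]))"

lemma prob_space_batch_law:
  assumes "prob_space P" and "estimation_procedure P A"
  shows "prob_space (batch_law P A m)"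
  using assms unfolding batch_law_def estimation_procedure_def
  by (intro prob_space.prob_space_distr prob_space_PiM) auto

text \<open>Reading a batch through its positions turns it into data indexed from 0, the form in
  which \<open>estimation_procedure\<close> states measurability.\<close>

lemma map_eq_map_reindex: "map x l = map (\<lambda>i\<in>{0..<length l}. x (l ! i)) [0..<length l]"
  by (auto intro: nth_equalityI)

lemma reindex_measurable:
  assumes "set l \<subseteq> K"
  shows "(\<lambda>x. \<lambda>i\<in>{0..<length l}. x (l ! i))
    \<in> measurable (Pi\<^sub>M K (\<lambda>_. P)) (Pi\<^sub>M {0..<length l} (\<lambda>_. P))"
  using assms by (intro measurable_restrict measurable_component_singleton) (auto simp: subset_iff)

lemma estimator_measurable:
  assumes "estimation_procedure P A" and "set l \<subseteq> K"
  shows "(\<lambda>x. A (map x l)) \<in> borel_measurable (Pi\<^sub>M K (\<lambda>_. P))"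
proof -
  have "(\<lambda>x. A (map x [0..<length l])) \<in> borel_measurable (Pi\<^sub>M {0..<length l} (\<lambda>_. P))"
    using assms(1) by (simp add: estimation_procedure_def)
  from measurable_compose[OF reindex_measurable[OF assms(2)] this] show ?thesis
    by (subst map_eq_map_reindex)
qed

text \<open>Distinct indices select coordinates whose joint law is again a product of copies of
  \<open>P\<close>, so only the batch size matters.\<close>

lemma distr_estimator:
  assumes "prob_space P" and A: "estimation_procedure P A" and l: "set l \<subseteq> K" "distinct l"
  shows "distr (Pi\<^sub>M K (\<lambda>_. P)) borel (\<lambda>x. A (map x l)) = batch_law P A (length l)"
proof -
  let ?m = "length l" and ?r = "\<lambda>x. \<lambda>i\<in>{0..<length l}. x (l ! i)"
  have "Pi\<^sub>M {0..<?m} (\<lambda>_. P) = distr (Pi\<^sub>M K (\<lambda>_. P)) (Pi\<^sub>M {0..<?m} (\<lambda>_. P)) ?r"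
    using assms
    by (intro distr_PiM_reindex[symmetric, of K "\<lambda>_. P" "(!) l" "{0..<?m}"]) (auto simp: inj_on_nth)
  then have "batch_law P A ?m = distr (distr (Pi\<^sub>M K (\<lambda>_. P)) (Pi\<^sub>M {0..<?m} (\<lambda>_. P)) ?r)
      borel (\<lambda>x. A (map x [0..<?m]))"
    by (simp add: batch_law_def)
  also have "\<dots> = distr (Pi\<^sub>M K (\<lambda>_. P)) borel ((\<lambda>x. A (map x [0..<?m])) \<circ> ?r)"
    using A by (intro distr_distr reindex_measurable l) (simp add: estimation_procedure_def)
  also have "(\<lambda>x. A (map x [0..<?m])) \<circ> ?r = (\<lambda>x. A (map x l))"
    by (subst (2) map_eq_map_reindex) (simp add: comp_def)
  finally show ?thesis by simp
qed

lemma indep_vars_PiM_components: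
  assumes "prob_space P" and "I \<noteq> {}"
  shows "prob_space.indep_vars (Pi\<^sub>M I (\<lambda>_. P)) (\<lambda>_. P) (\<lambda>i x. x i) I"
proof -
  interpret Q: prob_space "Pi\<^sub>M I (\<lambda>_. P)" using assms by (intro prob_space_PiM)
  have "distr (Pi\<^sub>M I (\<lambda>_. P)) (Pi\<^sub>M I (\<lambda>_. P)) (\<lambda>x. \<lambda>i\<in>I. x i)
      = distr (Pi\<^sub>M I (\<lambda>_. P)) (Pi\<^sub>M I (\<lambda>_. P)) (\<lambda>x. x)"
    by (intro distr_cong refl) (auto simp: space_PiM PiE_restrict)
  also have "\<dots> = Pi\<^sub>M I (\<lambda>i. distr (Pi\<^sub>M I (\<lambda>_. P)) P (\<lambda>x. x i))"
    using assms by (auto simp: distr_id intro!: PiM_cong distr_PiM_component[symmetric])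
  finally show ?thesis
    using assms(2) by (subst Q.indep_vars_iff_distr_eq_PiM') auto
qed

lemma batch_splitsD:
  assumes "s \<in> batch_splits n b" and "j \<in> {1..b}"
  shows "s j \<subseteq> {1..n}" "finite (s j)" "set (sorted_list_of_set (s j)) = s j"
    "length (sorted_list_of_set (s j)) = n div b"
proof -
  show "s j \<subseteq> {1..n}" using assms by (auto simp: batch_splits_def PiE_iff)
  then show "finite (s j)" by (rule finite_subset) simp
  then show "set (sorted_list_of_set (s j)) = s j" by simp
  show "length (sorted_list_of_set (s j)) = n div b"
    using assms by (auto simp: batch_splits_def)
qed

lemma finite_batch_splits [simp]: "finite (batch_splits n b)"
  by (rule finite_subset[of _ "{1..b} \<rightarrow>\<^sub>E Pow {1..n}"]) (auto simp: batch_splits_def intro!: finite_PiE)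

lemma batch_estimator_restrict:
  assumes "s \<in> batch_splits n b" and "j \<in> {1..b}"
  shows "batch_estimator A (restrict x {1..n}) s j = batch_estimator A x s j"
  unfolding batch_estimator_def using batch_splitsD[OF assms]
  by (intro arg_cong[where f = A] map_cong) (auto simp del: set_sorted_list_of_set)

lemma batch_estimator_measurable:
  assumes "estimation_procedure P A" "s \<in> batch_splits n b" and "j \<in> {1..b}"
  shows "(\<lambda>x. batch_estimator A x s j) \<in> borel_measurable (Pi\<^sub>M {1..n} (\<lambda>_. P))"
  unfolding batch_estimator_def using assms batch_splitsD[OF assms(2,3)]
  by (intro estimator_measurable) auto

lemma distr_batch_estimator:
  assumes "prob_space P" "estimation_procedure P A" "s \<in> batch_splits n b" and "j \<in> {1..b}"
  shows "distr (Pi\<^sub>M {1..n} (\<lambda>_. P)) borel (\<lambda>x. batch_estimator A x s j) = batch_law P A (n div b)"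
  unfolding batch_estimator_def
  using distr_estimator[OF assms(1,2), of "sorted_list_of_set (s j)" "{1..n}"]
    batch_splitsD[OF assms(3,4)] by simp

text \<open>For a fixed split the batch estimators are functions of disjoint blocks of coordinates
  of the product measure. They are therefore independent, and all have law
  \<open>batch_law\<close>.\<close>

lemma prob_not_in_rect_hull:
  fixes A :: "'x list \<Rightarrow> real ^ 'd::finite"
  assumes P: "prob_space P" and A: "estimation_procedure P A" and s: "s \<in> batch_splits n b"
    and "1 \<le> b" "1 \<le> n"
  shows "measure (Pi\<^sub>M {1..n} (\<lambda>_. P))
      {x \<in> space (Pi\<^sub>M {1..n} (\<lambda>_. P)). \<theta> \<notin> rect_hull b (batch_estimator A x s)}
    = one_sided_prob {1..b} (sgn_mass (distr (batch_law P A (n div b)) borel (\<lambda>y. y - \<theta>)))"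
proof -
  let ?Q = "Pi\<^sub>M {1..n} (\<lambda>_. P)"
  interpret Q: prob_space ?Q using P by (intro prob_space_PiM)
  let ?l = "\<lambda>j. sorted_list_of_set (s j)"
  note sD = batch_splitsD[OF s]
  have "Q.indep_vars (\<lambda>j. Pi\<^sub>M (s j) (\<lambda>_. P)) (\<lambda>j x. \<lambda>i\<in>s j. x i) {1..b}"
    using sD(1) s assms(5)
    by (intro Q.indep_vars_restrict[OF indep_vars_PiM_components[OF P]]) (auto simp: batch_splits_def)
  then have "Q.indep_vars (\<lambda>_. borel) (\<lambda>j x. A (map (\<lambda>i\<in>s j. x i) (?l j)) - \<theta>) {1..b}"
    by (rule Q.indep_vars_compose2[where Y = "\<lambda>j z. A (map z (?l j)) - \<theta>"])
      (intro borel_measurable_diff estimator_measurable[OF A] borel_measurable_const, simp add: sD(3))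
  also have "?this \<longleftrightarrow> Q.indep_vars (\<lambda>_. borel) (\<lambda>j x. batch_estimator A x s j - \<theta>) {1..b}"
    unfolding batch_estimator_def using sD(3)
    by (intro Q.indep_vars_cong refl)
      (auto intro!: ext arg_cong[where f = A] map_cong simp del: set_sorted_list_of_set)
  finally have indep: "Q.indep_vars (\<lambda>_. borel) (\<lambda>j x. batch_estimator A x s j - \<theta>) {1..b}" .
  have "distr ?Q borel (\<lambda>x. batch_estimator A x s j - \<theta>)
      = distr (batch_law P A (n div b)) borel (\<lambda>y. y - \<theta>)" if "j \<in> {1..b}" for j
    unfolding distr_batch_estimator[OF P A s that, symmetric]
    using batch_estimator_measurable[OF A s that] by (subst distr_distr) (auto simp: comp_def)
  from Q.prob_one_sided[OF _ _ indep this] show ?thesis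
    using assms(4) by (simp add: not_in_rect_hull_iff)
qed

lemma not_in_rect_hull_sets:
  fixes A :: "'x list \<Rightarrow> real ^ 'd::finite"
  assumes "estimation_procedure P A" and "s \<in> batch_splits n b" and "1 \<le> b"
  shows "{x \<in> space (Pi\<^sub>M {1..n} (\<lambda>_. P)). \<theta> \<notin> rect_hull b (batch_estimator A x s)}
    \<in> sets (Pi\<^sub>M {1..n} (\<lambda>_. P))"
proof -
  let ?Q = "Pi\<^sub>M {1..n} (\<lambda>_. P)"
  have [measurable]: "(\<lambda>x. batch_estimator A x s k $ j) \<in> borel_measurable ?Q" if "k \<in> {1..b}" for k j
    using batch_estimator_measurable[OF assms(1,2) that]
    by (rule measurable_compose) simp
  have "{x \<in> space ?Q. \<theta> \<notin> rect_hull b (batch_estimator A x s)} =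
      {x \<in> space ?Q. \<exists>j\<in>UNIV. (\<forall>k\<in>{1..b}. \<theta> $ j < batch_estimator A x s k $ j) \<or>
        (\<forall>k\<in>{1..b}. batch_estimator A x s k $ j < \<theta> $ j)}"
    using assms(3) by (simp add: not_in_rect_hull_iff one_sided_def sign_vec_def sgn_1_pos sgn_1_neg)
  also have "\<dots> \<in> sets ?Q" by measurable
  finally show ?thesis .
qed

text \<open>Meant for \<open>W\<close> a random split and \<open>\<Phi>\<close> an event about
  \<open>V\<close>. On each event \<open>W \<omega> = s\<close>, independence from \<open>X\<close>
  yields the factor \<open>g (G s) = c\<close>; being the same for all \<open>s\<close>, it survives
  the summation.\<close>

lemma (in prob_space) prob_randomised_event:
  assumes C: "finite C" "\<And>\<omega>. \<omega> \<in> space M \<Longrightarrow> W \<omega> \<in> C"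
    and X: "X \<in> measurable M Q"
    and W: "\<And>s. s \<in> C \<Longrightarrow> {\<omega> \<in> space M. \<Phi> \<omega> \<and> W \<omega> = s} \<in> events"
    and indep: "\<And>s E. s \<in> C \<Longrightarrow> E \<in> sets Q \<Longrightarrow>
      prob ({\<omega> \<in> space M. \<Phi> \<omega> \<and> W \<omega> = s} \<inter> (X -` E \<inter> space M))
        = prob {\<omega> \<in> space M. \<Phi> \<omega> \<and> W \<omega> = s} * g E"
    and G: "\<And>s. s \<in> C \<Longrightarrow> G s \<in> sets Q" "\<And>s. s \<in> C \<Longrightarrow> g (G s) = c"
  shows "{\<omega> \<in> space M. \<Phi> \<omega> \<and> X \<omega> \<in> G (W \<omega>)} \<in> events"
    and "prob {\<omega> \<in> space M. \<Phi> \<omega> \<and> X \<omega> \<in> G (W \<omega>)} = prob {\<omega> \<in> space M. \<Phi> \<omega>} * c"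
proof -
  let ?B = "\<lambda>s. {\<omega> \<in> space M. \<Phi> \<omega> \<and> W \<omega> = s}"
  let ?A = "\<lambda>s. ?B s \<inter> (X -` G s \<inter> space M)"
  have A: "?A s \<in> events" if "s \<in> C" for s
    using W G(1) X that by auto
  have eq: "{\<omega> \<in> space M. \<Phi> \<omega> \<and> X \<omega> \<in> G (W \<omega>)} = (\<Union>s\<in>C. ?A s)"
    "{\<omega> \<in> space M. \<Phi> \<omega>} = (\<Union>s\<in>C. ?B s)"
    using C(2) by auto
  show "{\<omega> \<in> space M. \<Phi> \<omega> \<and> X \<omega> \<in> G (W \<omega>)} \<in> events"
    unfolding eq using C(1) A by auto
  have "prob (\<Union>s\<in>C. ?A s) = (\<Sum>s\<in>C. prob (?A s))"
    using C(1) A by (intro finite_measure_finite_Union) (auto simp: disjoint_family_on_def)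
  also have "\<dots> = (\<Sum>s\<in>C. prob (?B s)) * c"
    using indep G by (simp add: sum_distrib_right)
  also have "(\<Sum>s\<in>C. prob (?B s)) = prob (\<Union>s\<in>C. ?B s)"
    using C(1) W by (intro finite_measure_finite_Union[symmetric]) (auto simp: disjoint_family_on_def)
  finally show "prob {\<omega> \<in> space M. \<Phi> \<omega> \<and> X \<omega> \<in> G (W \<omega>)} = prob {\<omega> \<in> space M. \<Phi> \<omega>} * c"
    unfolding eq .
qed

section \<open>The number of batches\<close>

text \<open>For b >= 1, \<open>hull_U b d \<le> \<alpha>\<close> amounts to 2 / 2^b <= y with y = 1
  - (1 - \<alpha>)^(1/d), that is, to b >= 1 - log 2 y. The ceiling is the least such b, and it is
  at least 2 because y < 1.\<close>

lemma batch_number_bounds: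
  assumes \<alpha>: "0 < \<alpha>" "\<alpha> < 1" and d: "1 \<le> d" and B: "B = batch_number \<alpha> d"
  shows "2 \<le> B" "hull_U B d \<le> \<alpha>" "\<alpha> < hull_U (B - 1) d"
proof -
  define r where "r = (1 - \<alpha>) powr (1 / real d)"
  define y where "y = 1 - r"
  have "r < 1" using powr_less_mono2[of "1 / real d" "1 - \<alpha>" 1] \<alpha> d by (simp add: r_def)
  have "0 < r" using \<alpha> by (simp add: r_def)
  have y: "0 < y" "y < 1" using \<open>0 < r\<close> \<open>r < 1\<close> by (auto simp: y_def)
  have rd: "r ^ d = 1 - \<alpha>"
    using \<alpha> d by (simp add: r_def powr_realpow[symmetric] powr_powr)
  have "log 2 y < 0" using y by simp
  then have ceil: "1 < 1 - log 2 y" by simp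
  have B_eq: "real B = of_int \<lceil>1 - log 2 y\<rceil>"
    using ceil by (simp add: B batch_number_def y_def r_def)
  have B_ge: "1 - log 2 y \<le> real B" and B_lt: "real B < 1 - log 2 y + 1"
    unfolding B_eq by linarith+
  have "1 < real B" using B_ge ceil by simp
  then show B2: "2 \<le> B" by simp
  have "2 powr log 2 y = y" using y by simp
  have pow: "2 / 2 ^ b = 2 powr (1 - real b)" for b :: nat
    by (simp add: powr_diff powr_realpow)
  have "2 / 2 ^ B \<le> y"
    unfolding pow using powr_mono[of "1 - real B" "log 2 y" 2] B_ge \<open>2 powr log 2 y = y\<close> by simp
  then have "r ^ d \<le> (1 - 2 / 2 ^ B) ^ d"
    using \<open>0 < r\<close> by (intro power_mono) (auto simp: y_def)
  then show "hull_U B d \<le> \<alpha>" using hull_U_closed_form[of B d] B2 d rd by simp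
  have "y < 2 / 2 ^ (B - 1)"
    unfolding pow using powr_less_mono[of "log 2 y" "1 - real (B - 1)" 2] B_lt B2 \<open>2 powr log 2 y = y\<close>
    by (simp add: of_nat_diff)
  \<comment> \<open>Makes the base \<open>1 - 2 / 2 ^ (B - 1)\<close> non-negative, as strict
    monotonicity of powers requires.\<close>
  moreover have "(2::real) ^ 1 \<le> 2 ^ (B - 1)"
    using B2 by (intro power_increasing) auto
  ultimately have "(1 - 2 / 2 ^ (B - 1)) ^ d < r ^ d"
    using d by (intro power_strict_mono) (auto simp: y_def field_simps)
  then show "\<alpha> < hull_U (B - 1) d" using hull_U_closed_form[of "B - 1" d] B2 d rd by simp
qed

text \<open>The threshold is the weight that writes \<alpha>, which lies between the two values of
  \<open>hull_U\<close>, as their convex combination.\<close>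

lemma batch_number_mixture:
  assumes \<alpha>: "0 < \<alpha>" "\<alpha> < 1" and d: "1 \<le> d"
  shows "0 \<le> rand_threshold \<alpha> d" "rand_threshold \<alpha> d \<le> 1"
    "rand_threshold \<alpha> d * hull_U (batch_number \<alpha> d - 1) d
      + (1 - rand_threshold \<alpha> d) * hull_U (batch_number \<alpha> d) d = \<alpha>"
proof -
  let ?U = "hull_U (batch_number \<alpha> d) d" and ?U' = "hull_U (batch_number \<alpha> d - 1) d"
  have U: "?U \<le> \<alpha>" "\<alpha> < ?U'" using batch_number_bounds[OF \<alpha> d refl] by auto
  then show "0 \<le> rand_threshold \<alpha> d" "rand_threshold \<alpha> d \<le> 1"
    by (auto simp: rand_threshold_def divide_simps)
  have "rand_threshold \<alpha> d * (?U' - ?U) = \<alpha> - ?U"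
    using U by (simp add: rand_threshold_def)
  then show "rand_threshold \<alpha> d * ?U' + (1 - rand_threshold \<alpha> d) * ?U = \<alpha>"
    by (simp add: algebra_simps)
qed

lemma measure_le_of_uniform:
  assumes V: "distr M lborel V = uniform_measure lborel {0..1::real}" "V \<in> borel_measurable M"
    and t: "0 \<le> t" "t \<le> 1"
  shows "measure M {\<omega> \<in> space M. V \<omega> \<le> t} = t"
proof -
  have "{0..1} \<inter> {..t} = {0..t}" using t by auto
  then have "measure (uniform_measure lborel {0..1}) {..t} = t" using t by simp
  moreover have "measure (distr M lborel V) {..t} = measure M (V -` {..t} \<inter> space M)"
    using V(2) by (intro measure_distr) auto
  ultimately show ?thesis unfolding V(1)[symmetric]
    by (simp add: vimage_def Int_def conj_commute)
qed

theorem theorem3p5: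
  fixes M :: "'w measure" and P :: "'x measure"
    and X :: "nat \<Rightarrow> 'w \<Rightarrow> 'x" and V :: "'w \<Rightarrow> real"
    and S :: "nat \<Rightarrow> 'w \<Rightarrow> nat \<Rightarrow> nat set"
    and A :: "'x list \<Rightarrow> real ^ 'd::finite" and \<theta>\<^sub>0 :: "real ^ 'd"
    and \<alpha> \<delta> :: real and n B :: nat
  assumes "prob_space M"
    and "0 < \<alpha>" and "\<alpha> < 1"
    and "B = batch_number \<alpha> CARD('d)" and "B \<le> n"
    and "prob_space.indep_vars M (\<lambda>_. P) X {1..n}"
    and "\<And>i. i \<in> {1..n} \<Longrightarrow> distr M P (X i) = P"
    and "distr M lborel V = uniform_measure lborel {0..1}"
    and "indep_rvs M
           (Pi\<^sub>M {1..n} (\<lambda>_. P)) (\<lambda>\<omega>. \<lambda>i\<in>{1..n}. X i \<omega>)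
           (borel \<Otimes>\<^sub>M count_space (batch_splits n (B - 1)) \<Otimes>\<^sub>M count_space (batch_splits n B))
           (\<lambda>\<omega>. (V \<omega>, S (B - 1) \<omega>, S B \<omega>))"
    and "estimation_procedure P A"
    and "0 \<le> \<delta>"
    and "\<And>b j. b \<in> {B - 1, B} \<Longrightarrow> j \<in> {1..b} \<Longrightarrow>
           o_med_bias M (\<lambda>\<omega>. batch_estimator A (\<lambda>i. X i \<omega>) (S b \<omega>) j) \<theta>\<^sub>0 \<le> \<delta>"
  shows "measure M {\<omega> \<in> space M. \<theta>\<^sub>0 \<notin> hull_CI \<alpha> A (\<lambda>i. X i \<omega>) (V \<omega>) (\<lambda>b. S b \<omega>)}
           \<le> \<alpha> + 2 ^ (CARD('d) - 1) * real B * (real B - 1) * \<delta>\<^sup>2"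
proof -
  interpret M: prob_space M by fact
  note \<alpha> = assms(2,3) and A = assms(10)

  \<comment> \<open>Laws and independence of the data, the uniform variate and the splits\<close>
  define Q where "Q = Pi\<^sub>M {1..n} (\<lambda>_. P)"
  define XX where "XX \<omega> = (\<lambda>i\<in>{1..n}. X i \<omega>)" for \<omega>
  let ?C = "batch_splits n"
  let ?Z = "\<lambda>\<omega>. (V \<omega>, S (B - 1) \<omega>, S B \<omega>)"
  let ?K = "borel \<Otimes>\<^sub>M count_space (?C (B - 1)) \<Otimes>\<^sub>M count_space (?C B)"
  have D: "1 \<le> CARD('d)" by (simp add: Suc_leI)
  have B2: "2 \<le> B" using batch_number_bounds(1)[OF \<alpha> D assms(4)] .
  then have n: "1 \<le> n" using assms(5) by simp
  have rv: "X i \<in> measurable M P" if "i \<in> {1..n}" for i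
    using assms(6) that by (auto simp: M.indep_vars_def)
  have P: "prob_space P"
    using assms(7)[of 1] M.prob_space_distr[OF rv[of 1]] n by simp
  have XX: "XX \<in> measurable M Q" and Z: "?Z \<in> measurable M ?K"
    and indep: "M.indep_set {XX -` E \<inter> space M | E. E \<in> sets Q} {?Z -` F \<inter> space M | F. F \<in> sets ?K}"
    using assms(9) unfolding indep_rvs_def XX_def[abs_def] Q_def by blast+
  have "distr M Q XX = Pi\<^sub>M {1..n} (\<lambda>i. distr M P (X i))"
    using M.indep_vars_iff_distr_eq_PiM'[of "{1..n}" X "\<lambda>_. P"] assms(6) rv n
    by (simp add: Q_def XX_def[abs_def])
  also have "\<dots> = Q" unfolding Q_def using assms(7) by (intro PiM_cong) auto
  finally have lawX: "distr M Q XX = Q" .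
  have probX: "M.prob (XX -` E \<inter> space M) = measure Q E" if "E \<in> sets Q" for E
    using measure_distr[OF XX that] by (simp add: lawX)
  have V: "V \<in> borel_measurable M"
    using measurable_compose[OF Z measurable_fst] by simp
  have S_in: "S b \<omega> \<in> ?C b" if "\<omega> \<in> space M" "b \<in> {B - 1, B}" for b \<omega>
    using measurable_space[OF Z that(1)] that(2) by (auto simp: space_pair_measure)
  have joint: "{\<omega> \<in> space M. V \<omega> \<in> K \<and> S b \<omega> = s} \<in> M.events"
    "M.prob ({\<omega> \<in> space M. V \<omega> \<in> K \<and> S b \<omega> = s} \<inter> (XX -` E \<inter> space M))
      = M.prob {\<omega> \<in> space M. V \<omega> \<in> K \<and> S b \<omega> = s} * measure Q E"
    if b: "b \<in> {B - 1, B}" and s: "s \<in> ?C b" and K: "K \<in> sets borel" and E: "E \<in> sets Q" for b s K E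
  proof -
    \<comment> \<open>The set \<open>F\<close> is a measurable rectangle in which the split for the
      other number of batches ranges freely.\<close>
    obtain F where F: "F \<in> sets ?K" "{\<omega> \<in> space M. V \<omega> \<in> K \<and> S b \<omega> = s} = ?Z -` F \<inter> space M"
    proof (cases "b = B")
      case True
      then show ?thesis
        using S_in[of _ "B - 1"] s K by (intro that[of "K \<times> ?C (B - 1) \<times> {s}"]) auto
    next
      case False
      then have "b = B - 1" using b by simp
      then show ?thesis
        using S_in[of _ B] s K by (intro that[of "K \<times> {s} \<times> ?C B"]) auto
    qed
    show "{\<omega> \<in> space M. V \<omega> \<in> K \<and> S b \<omega> = s} \<in> M.events"
      unfolding F(2) using Z F(1) by (rule measurable_sets)
    show "M.prob ({\<omega> \<in> space M. V \<omega> \<in> K \<and> S b \<omega> = s} \<inter> (XX -` E \<inter> space M))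
        = M.prob {\<omega> \<in> space M. V \<omega> \<in> K \<and> S b \<omega> = s} * measure Q E"
      using M.indep_setD[OF indep, of "XX -` E \<inter> space M" "?Z -` F \<inter> space M"] E F(1) probX
      unfolding F(2) by (auto simp: Int_commute mult.commute)
  qed
  \<comment> \<open>Used below with \<open>K\<close> the whole line, for the law of an estimator,
    and with the half-lines on either side of the threshold.\<close>
  have rand: "{\<omega> \<in> space M. V \<omega> \<in> K \<and> XX \<omega> \<in> G (S b \<omega>)} \<in> M.events"
    "M.prob {\<omega> \<in> space M. V \<omega> \<in> K \<and> XX \<omega> \<in> G (S b \<omega>)} = M.prob {\<omega> \<in> space M. V \<omega> \<in> K} * c"
    if b: "b \<in> {B - 1, B}" and K: "K \<in> sets borel"
      and G: "\<And>s. s \<in> ?C b \<Longrightarrow> G s \<in> sets Q" "\<And>s. s \<in> ?C b \<Longrightarrow> measure Q (G s) = c" for b K G c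
  proof -
    note R = M.prob_randomised_event[where W = "S b" and \<Phi> = "\<lambda>\<omega>. V \<omega> \<in> K" and G = G and c = c
        and g = "measure Q", OF finite_batch_splits S_in[OF _ b] XX
        joint(1)[OF b _ K sets.empty_sets] joint(2)[OF b _ K] G]
    show "{\<omega> \<in> space M. V \<omega> \<in> K \<and> XX \<omega> \<in> G (S b \<omega>)} \<in> M.events"
      by (rule R(1))
    show "M.prob {\<omega> \<in> space M. V \<omega> \<in> K \<and> XX \<omega> \<in> G (S b \<omega>)} = M.prob {\<omega> \<in> space M. V \<omega> \<in> K} * c"
      by (rule R(2))
  qed
  have est: "batch_estimator A (\<lambda>i. X i \<omega>) (S b \<omega>) j = batch_estimator A (XX \<omega>) (S b \<omega>) j"
    if "\<omega> \<in> space M" "b \<in> {B - 1, B}" "j \<in> {1..b}" for \<omega> b j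
    using batch_estimator_restrict[OF S_in[OF that(1,2)] that(3), of A "\<lambda>i. X i \<omega>"]
    by (simp add: XX_def)

  \<comment> \<open>Law of an estimator on a random batch\<close>
  define L where "L b = distr (batch_law P A (n div b)) borel (\<lambda>y. y - \<theta>\<^sub>0)" for b
  have prob_L: "prob_space (L b)" for b
    unfolding L_def
    by (intro prob_space.prob_space_distr prob_space_batch_law P A) (simp add: batch_law_def)
  \<comment> \<open>All splits into \<open>b\<close> batches give the same law, so drawing the split
    at random leaves it unchanged. Measurability of the estimator comes out of the same
    decomposition over splits.\<close>
  have law: "distr M borel (\<lambda>\<omega>. batch_estimator A (\<lambda>i. X i \<omega>) (S b \<omega>) j - \<theta>\<^sub>0) = L b"
    if b: "b \<in> {B - 1, B}" and j: "j \<in> {1..b}" for b j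
  proof -
    let ?T = "\<lambda>\<omega>. batch_estimator A (\<lambda>i. X i \<omega>) (S b \<omega>) j - \<theta>\<^sub>0"
    have events: "?T -` E \<inter> space M \<in> M.events" and probs: "M.prob (?T -` E \<inter> space M) = measure (L b) E"
      if E: "E \<in> sets borel" for E
    proof -
      let ?G = "\<lambda>s. {x \<in> space Q. batch_estimator A x s j - \<theta>\<^sub>0 \<in> E}"
      have G: "?G s \<in> sets Q" "measure Q (?G s) = measure (L b) E" if s: "s \<in> ?C b" for s
      proof -
        have m [measurable]: "(\<lambda>x. batch_estimator A x s j) \<in> borel_measurable Q"
          unfolding Q_def by (rule batch_estimator_measurable[OF A s j])
        have [measurable]: "E \<in> sets borel" by fact
        show "?G s \<in> sets Q" by measurable
        have "L b = distr Q borel (\<lambda>x. batch_estimator A x s j - \<theta>\<^sub>0)"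
          unfolding L_def distr_batch_estimator[OF P A s j, folded Q_def, symmetric]
          by (subst distr_distr) (auto simp: comp_def)
        then show "measure Q (?G s) = measure (L b) E"
          by (simp add: measure_distr vimage_def Int_def conj_commute)
      qed
      have eq: "?T -` E \<inter> space M = {\<omega> \<in> space M. V \<omega> \<in> UNIV \<and> XX \<omega> \<in> ?G (S b \<omega>)}"
        using est[OF _ b j] measurable_space[OF XX] by auto
      show "?T -` E \<inter> space M \<in> M.events"
        unfolding eq by (rule rand(1)[of b UNIV ?G, OF b borel_open[OF open_UNIV] G])
      have "M.prob (?T -` E \<inter> space M) = M.prob {\<omega> \<in> space M. V \<omega> \<in> UNIV} * measure (L b) E"
        unfolding eq by (rule rand(2)[of b UNIV ?G, OF b borel_open[OF open_UNIV] G])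
      then show "M.prob (?T -` E \<inter> space M) = measure (L b) E"
        by (simp add: M.prob_space)
    qed
    have T: "?T \<in> borel_measurable M"
      using events by (intro measurableI) auto
    interpret L: prob_space "L b" using prob_L .
    show ?thesis
    proof (rule measure_eqI)
      fix E assume "E \<in> sets (distr M borel ?T)"
      then show "emeasure (distr M borel ?T) E = emeasure (L b) E"
        using probs[of E] T by (simp add: emeasure_distr M.emeasure_eq_measure L.emeasure_eq_measure)
    qed (simp add: L_def)
  qed

  \<comment> \<open>Miss probability for a given number of batches\<close>
  let ?f = "\<lambda>b. one_sided_prob {1..b} (sgn_mass (L b))"
  let ?c = "\<lambda>b. 2 ^ (CARD('d) - 1) * real b * (real b - 1) * \<delta>\<^sup>2"
  \<comment> \<open>Since \<open>1 \<le> b\<close>, batch 1 exists and its error has law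
    \<open>L b\<close>, which turns the assumed bias bound into one on
    \<open>OMB (L b)\<close>.\<close>
  have f_le: "?f b \<le> hull_U b CARD('d) + ?c b" if b: "b \<in> {B - 1, B}" for b
  proof (rule one_sided_prob_le_of_OMB)
    show "1 \<le> b" using b B2 by auto
    then show "OMB (L b) \<le> \<delta>"
      using assms(12)[OF b, of 1] law[OF b, of 1] by (simp add: o_med_bias_def)
    show "L b \<in> space (prob_algebra borel)"
      using prob_L[of b] by (simp add: space_prob_algebra L_def)
  qed
  let ?miss = "\<lambda>b \<omega>. \<theta>\<^sub>0 \<notin> rect_hull b (batch_estimator A (\<lambda>i. X i \<omega>) (S b \<omega>))"
  \<comment> \<open>Every split has miss probability \<open>?f b\<close>, so the event about
    \<open>V\<close> factors out.\<close>
  have miss: "{\<omega> \<in> space M. V \<omega> \<in> K \<and> ?miss b \<omega>} \<in> M.events"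
    "M.prob {\<omega> \<in> space M. V \<omega> \<in> K \<and> ?miss b \<omega>} = M.prob {\<omega> \<in> space M. V \<omega> \<in> K} * ?f b"
    if b: "b \<in> {B - 1, B}" and K: "K \<in> sets borel" for b K
  proof -
    have b1: "1 \<le> b" using b B2 by auto
    let ?G = "\<lambda>s. {x \<in> space Q. \<theta>\<^sub>0 \<notin> rect_hull b (batch_estimator A x s)}"
    have G: "?G s \<in> sets Q" "measure Q (?G s) = ?f b" if s: "s \<in> ?C b" for s
      using not_in_rect_hull_sets[OF A s b1] prob_not_in_rect_hull[OF P A s b1 n]
      by (simp_all add: Q_def L_def)
    have "?miss b \<omega> \<longleftrightarrow> XX \<omega> \<in> ?G (S b \<omega>)" if "\<omega> \<in> space M" for \<omega>
      using est[OF that b] measurable_space[OF XX that] b1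
      by (simp add: not_in_rect_hull_iff one_sided_def)
    then have eq: "{\<omega> \<in> space M. V \<omega> \<in> K \<and> ?miss b \<omega>} = {\<omega> \<in> space M. V \<omega> \<in> K \<and> XX \<omega> \<in> ?G (S b \<omega>)}"
      by auto
    show "{\<omega> \<in> space M. V \<omega> \<in> K \<and> ?miss b \<omega>} \<in> M.events"
      unfolding eq by (rule rand(1)[of b K ?G, OF b K G])
    show "M.prob {\<omega> \<in> space M. V \<omega> \<in> K \<and> ?miss b \<omega>} = M.prob {\<omega> \<in> space M. V \<omega> \<in> K} * ?f b"
      unfolding eq by (rule rand(2)[of b K ?G, OF b K G])
  qed

  \<comment> \<open>Averaging over the number of batches\<close>
  define t where "t = rand_threshold \<alpha> CARD('d)"
  note t = batch_number_mixture[OF \<alpha> D, folded assms(4) t_def]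
  have probV: "M.prob {\<omega> \<in> space M. V \<omega> \<in> {..t}} = t"
    using measure_le_of_uniform[OF assms(8) V t(1,2)] by simp
  have "{\<omega> \<in> space M. V \<omega> \<in> {t<..}} = space M - {\<omega> \<in> space M. V \<omega> \<in> {..t}}" by auto
  moreover have "{\<omega> \<in> space M. V \<omega> \<in> {..t}} \<in> M.events"
    using measurable_sets[OF V, of "{..t}"] by (simp add: vimage_def Int_def conj_commute)
  ultimately have probV': "M.prob {\<omega> \<in> space M. V \<omega> \<in> {t<..}} = 1 - t"
    by (simp add: M.prob_compl probV del: atMost_iff)
  \<comment> \<open>Values of \<open>V\<close> up to \<open>t\<close> select \<open>B - 1\<close>
    batches and larger ones select \<open>B\<close>, so the miss event falls into two disjoint
    parts.\<close>
  have "{\<omega> \<in> space M. \<theta>\<^sub>0 \<notin> hull_CI \<alpha> A (\<lambda>i. X i \<omega>) (V \<omega>) (\<lambda>b. S b \<omega>)} =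
      {\<omega> \<in> space M. V \<omega> \<in> {..t} \<and> ?miss (B - 1) \<omega>} \<union> {\<omega> \<in> space M. V \<omega> \<in> {t<..} \<and> ?miss B \<omega>}"
    by (auto simp: hull_CI_def rand_batch_number_def Let_def t_def assms(4))
  also have "M.prob \<dots> = t * ?f (B - 1) + (1 - t) * ?f B"
    using miss[of "B - 1" "{..t}"] miss[of B "{t<..}"] unfolding probV probV'
    by (subst M.finite_measure_Union) auto
  also have "\<dots> \<le> t * (hull_U (B - 1) CARD('d) + ?c (B - 1)) + (1 - t) * (hull_U B CARD('d) + ?c B)"
    using t f_le by (intro add_mono mult_left_mono) auto
  also have "\<dots> = \<alpha> + (t * ?c (B - 1) + (1 - t) * ?c B)"
    using t(3) by (simp add: algebra_simps)
  \<comment> \<open>The bias term is larger for \<open>B\<close> batches than for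
    \<open>B - 1\<close>, or equal.\<close>
  also have "t * ?c (B - 1) + (1 - t) * ?c B \<le> t * ?c B + (1 - t) * ?c B"
    using B2 t by (intro add_mono mult_left_mono mult_right_mono mult_mono order.refl) auto
  finally show ?thesis by (simp add: algebra_simps)
qed

end
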